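(* Let $k\ge 2$, let $G$ be a connected $k$-uniform hypergraph with $|E(G)|\ge 2$, let $e\in E(G)$, and let $u,v\in e$ be distinct vertices. Suppose that $G-e$ consists of $k$ components. Then for all integers $p,q\ge 1$, $$\rho(G_{u,v}(p,q))<\rho(G_{u,v}(p-1,q+1))\quad\text{or}\quad \rho(G_{u,v}(p,q))<\rho(G_{u,v}(p+1,q-1)).$$
   Context: All hypergraphs are finite. A hypergraph $G$ consists of a nonempty vertex set $V(G)$ and an edge set $E(G)$ whose elements are nonempty subsets of $V(G)$. It is $k$-uniform ($k\ge 2$) if every edge has exactly $k$ vertices. A walk of length $p$ from $u$ to $v$ is a sequence $(v_0,e_1,v_1,\dots,v_{p-1},e_p,v_p)$ with $v_0=u$, $v_p=v$, each $e_i$ an edge containing $v_{i-1}$ and $v_i$, and $v_{i-1}\ne v_i$. A path is a walk with all $v_i$ distinct and all $e_i$ distinct; a single vertex is a path of length $0$. $G$ is connected if there is a path between any two vertices; a component is a maximal connected sub-hypergraph. For $e\in E(G)$, $G-e$ is obtained from $G$ by deleting the edge $e$ (keeping all vertices). For connected $G$, the distance $d_G(u,v)$ is the length of a shortest path from $u$ to $v$ (with $d_G(u,u)=0$), the distance matrix is $D(G)=(d_G(u,v))_{u,v\in V(G)}$, and the distance spectral radius $\rho(G)$ is the largest eigenvalue of $D(G)$. Attaching a pendant path of length $p\ge 1$ at a vertex $u$ of a $k$-uniform hypergraph means adding $p(k-1)$ new vertices and $p$ new edges $e_1,\dots,e_p$ of size $k$ forming a path $(u_0,e_1,u_1,\dots,u_{p-1},e_p,u_p)$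 with $u_0=u$, such that all vertices of $e_1\cup\dots\cup e_p$ other than $u$ are new, $e_i\cap e_{i+1}=\{u_i\}$ for $1\le i\le p-1$, and every new vertex other than $u_1,\dots,u_{p-1}$ lies in exactly one edge. For positive integers $p,q$, $G_{u,v}(p,q)$ is the $k$-uniform hypergraph obtained from $G$ by attaching a pendant path of length $p$ at $u$ and a pendant path of length $q$ at $v$ (with disjoint sets of new vertices); $G_{u,v}(p,0)$ is obtained from $G$ by attaching only a pendant path of length $p$ at $u$; and $G_{u,v}(0,q)$ is obtained from $G$ by attaching only a pendant path of length $q$ at $v$. *)

theory Defs
  imports Complex_Main "Jordan_Normal_Form.Char_Poly"
begin

section \<open>Hypergraphs\<close>

record 'a hypergraph =
  verts :: "'a set"
  edges :: "'a set set"

definition hypergraph :: "'a hypergraph \<Rightarrow> bool" where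
  "hypergraph G \<longleftrightarrow> finite (verts G) \<and> verts G \<noteq> {} \<and>
     (\<forall>e\<in>edges G. e \<noteq> {} \<and> e \<subseteq> verts G)"

definition uniform :: "nat \<Rightarrow> 'a hypergraph \<Rightarrow> bool" where
  "uniform k G \<longleftrightarrow> (\<forall>e\<in>edges G. card e = k)"

definition delete_edge :: "'a hypergraph \<Rightarrow> 'a set \<Rightarrow> 'a hypergraph" where
  "delete_edge G e = \<lparr>verts = verts G, edges = edges G - {e}\<rparr>"

text \<open>A walk \<open>(v\<^sub>0, e\<^sub>1, v\<^sub>1, \<dots>, e\<^sub>p, v\<^sub>p)\<close> is given by the list \<open>vs\<close> of its \<open>p + 1\<close> vertices and the
  list \<open>es\<close> of its \<open>p\<close> edges, so that \<open>es ! i\<close> joins \<open>vs ! i\<close> and \<open>vs ! Suc i\<close>.\<close>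

definition walk :: "'a hypergraph \<Rightarrow> 'a list \<Rightarrow> 'a set list \<Rightarrow> bool" where
  "walk G vs es \<longleftrightarrow> length vs = Suc (length es) \<and> set vs \<subseteq> verts G \<and>
     (\<forall>i<length es. es ! i \<in> edges G \<and> vs ! i \<in> es ! i \<and> vs ! Suc i \<in> es ! i \<and>
        vs ! i \<noteq> vs ! Suc i)"

definition hpath :: "'a hypergraph \<Rightarrow> 'a \<Rightarrow> 'a list \<Rightarrow> 'a set list \<Rightarrow> 'a \<Rightarrow> bool" where
  "hpath G u vs es v \<longleftrightarrow> walk G vs es \<and> hd vs = u \<and> last vs = v \<and> distinct vs \<and> distinct es"

definition hconnected :: "'a hypergraph \<Rightarrow> bool" where
  "hconnected G \<longleftrightarrow> (\<forall>u\<in>verts G. \<forall>v\<in>verts G. \<exists>vs es. hpath G u vs es v)"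

definition subhypergraph :: "'a hypergraph \<Rightarrow> 'a hypergraph \<Rightarrow> bool" where
  "subhypergraph H G \<longleftrightarrow> hypergraph H \<and> verts H \<subseteq> verts G \<and> edges H \<subseteq> edges G"

definition components :: "'a hypergraph \<Rightarrow> 'a hypergraph set" where
  "components G = {H. subhypergraph H G \<and> hconnected H \<and>
     (\<forall>H'. subhypergraph H' G \<and> hconnected H' \<and> subhypergraph H H' \<longrightarrow> H' = H)}"

section \<open>Distance spectral radius\<close>

text \<open>Only meaningful for connected \<open>G\<close>.\<close>

definition hdist :: "'a hypergraph \<Rightarrow> 'a \<Rightarrow> 'a \<Rightarrow> nat" where
  "hdist G u v = (LEAST n. \<exists>vs es. hpath G u vs es v \<and> length es = n)"

text \<open>Matrices of the library are indexed by initial segments of the naturals, so the vertices are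
  put in an arbitrary order. Lemma \<open>eigenvalue_distance_matrix_iff\<close> shows that the eigenvalues do not
  depend on it.\<close>

definition vertex_list :: "'a hypergraph \<Rightarrow> 'a list" where
  "vertex_list G = (SOME xs. distinct xs \<and> set xs = verts G)"

definition distance_matrix :: "'a hypergraph \<Rightarrow> real mat" where
  "distance_matrix G = mat (card (verts G)) (card (verts G))
     (\<lambda>(i, j). real (hdist G (vertex_list G ! i) (vertex_list G ! j)))"

text \<open>The distance matrix is real symmetric, so all its complex eigenvalues are real.\<close>

definition distance_spectral_radius :: "'a hypergraph \<Rightarrow> real" where
  "distance_spectral_radius G = Max {r. eigenvalue (distance_matrix G) r}"

lemma vertex_list:
  assumes "finite (verts G)"
  shows "distinct (vertex_list G)" "set (vertex_list G) = verts G"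
    "length (vertex_list G) = card (verts G)"
proof -
  have "\<exists>xs. distinct xs \<and> set xs = verts G"
    using finite_distinct_list[OF assms] by blast
  then have *: "distinct (vertex_list G) \<and> set (vertex_list G) = verts G"
    unfolding vertex_list_def by (rule someI_ex)
  then show "distinct (vertex_list G)" "set (vertex_list G) = verts G"
    "length (vertex_list G) = card (verts G)"
    using distinct_card[of "vertex_list G"] by simp_all
qed

lemma eigenvalue_distance_matrix_iff:
  assumes fin: "finite (verts G)"
  shows "eigenvalue (distance_matrix G) r \<longleftrightarrow>
    (\<exists>x. (\<exists>u\<in>verts G. x u \<noteq> 0) \<and>
       (\<forall>u\<in>verts G. (\<Sum>v\<in>verts G. real (hdist G u v) * x v) = r * x u))" (is "_ \<longleftrightarrow> ?R")
proof -
  define n where "n = card (verts G)"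
  define f where "f = (!) (vertex_list G)"
  have bij: "bij_betw f {0..<n} (verts G)"
    unfolding f_def
    by (rule bij_betw_nth) (simp_all add: vertex_list[OF fin] n_def atLeast0LessThan)
  have f_in: "f i \<in> verts G" if "i < n" for i
    using bij that by (auto dest: bij_betwE)
  have f_surj: "\<exists>i<n. u = f i" if "u \<in> verts G" for u
  proof -
    have "u \<in> f ` {0..<n}" using bij that by (simp add: bij_betw_def)
    then show ?thesis by auto
  qed
  have D: "distance_matrix G = mat n n (\<lambda>(i, j). real (hdist G (f i) (f j)))"
    unfolding distance_matrix_def n_def f_def ..
  have mult: "(distance_matrix G *\<^sub>v vec n (\<lambda>i. x (f i))) $ i
      = (\<Sum>v\<in>verts G. real (hdist G (f i) v) * x v)" if "i < n" for i x
  proof -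
    have "(distance_matrix G *\<^sub>v vec n (\<lambda>i. x (f i))) $ i
        = (\<Sum>j = 0..<n. real (hdist G (f i) (f j)) * x (f j))"
      using that by (simp add: D scalar_prod_def)
    also have "\<dots> = (\<Sum>v\<in>verts G. real (hdist G (f i) v) * x v)"
      by (rule sum.reindex_bij_betw[OF bij])
    finally show ?thesis .
  qed
  show ?thesis
  proof
    assume "eigenvalue (distance_matrix G) r"
    then obtain w where w: "w \<in> carrier_vec n" "w \<noteq> 0\<^sub>v n" "distance_matrix G *\<^sub>v w = r \<cdot>\<^sub>v w"
      unfolding eigenvalue_def eigenvector_def D by auto
    define x where "x u = w $ the_inv_into {0..<n} f u" for u
    have x: "x (f i) = w $ i" if "i < n" for i
      using that the_inv_into_f_f[of f "{0..<n}" i] bij by (simp add: x_def bij_betw_def)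
    have wx: "w = vec n (\<lambda>i. x (f i))"
      using w(1) x by (intro eq_vecI) auto
    have "\<exists>i<n. w $ i \<noteq> 0"
    proof (rule ccontr)
      assume "\<not> ?thesis"
      then have "w = 0\<^sub>v n" using w(1) by (intro eq_vecI) auto
      with w(2) show False by simp
    qed
    then obtain i where "i < n" "w $ i \<noteq> 0" by blast
    then have "\<exists>u\<in>verts G. x u \<noteq> 0" using x f_in by (intro bexI[of _ "f i"]) simp_all
    moreover have "(\<Sum>v\<in>verts G. real (hdist G u v) * x v) = r * x u" if u: "u \<in> verts G" for u
    proof -
      obtain i where i: "i < n" "u = f i" using f_surj[OF u] by blast
      have "(\<Sum>v\<in>verts G. real (hdist G u v) * x v) = (distance_matrix G *\<^sub>v w) $ i"
        unfolding i(2) mult[OF i(1), of x, symmetric] wx[symmetric] ..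
      also have "\<dots> = r * x u" using w i x by simp
      finally show ?thesis .
    qed
    ultimately show ?R by blast
  next
    assume ?R
    then obtain x u where u: "u \<in> verts G" "x u \<noteq> 0" and
      x: "\<And>u. u \<in> verts G \<Longrightarrow> (\<Sum>v\<in>verts G. real (hdist G u v) * x v) = r * x u" by blast
    define w where "w = vec n (\<lambda>i. x (f i))"
    obtain i where "i < n" "u = f i" using f_surj[OF u(1)] by blast
    then have "w $ i \<noteq> 0\<^sub>v n $ i" using u(2) by (simp add: w_def)
    then have "w \<noteq> 0\<^sub>v n" by blast
    moreover have "distance_matrix G *\<^sub>v w = r \<cdot>\<^sub>v w"
    proof (rule eq_vecI)
      fix j assume "j < dim_vec (r \<cdot>\<^sub>v w)"
      then have j: "j < n" by (simp add: w_def)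
      show "(distance_matrix G *\<^sub>v w) $ j = (r \<cdot>\<^sub>v w) $ j"
        using mult[OF j, of x] x[OF f_in[OF j]] j by (simp add: w_def)
    qed (simp add: D w_def)
    ultimately show "eigenvalue (distance_matrix G) r"
      unfolding eigenvalue_def eigenvector_def by (intro exI[of _ w]) (simp add: D w_def)
  qed
qed

section \<open>Attaching pendant paths\<close>

text \<open>The old vertices are tagged with \<open>Inl\<close>. The new vertices are \<open>Inr (i, j)\<close> with \<open>i < p\<close> and
  \<open>j < k - 1\<close>: the pair \<open>(i, j)\<close> is the \<open>j\<close>-th of the \<open>k - 1\<close> vertices that \<open>e\<^bsub>i+1\<^esub>\<close> contributes, and
  \<open>(i, 0)\<close> plays the role of \<open>u\<^bsub>i+1\<^esub>\<close>. For \<open>p = 0\<close> the result is a copy of \<open>G\<close>.\<close>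

fun path_vertex :: "'a \<Rightarrow> nat \<Rightarrow> 'a + nat \<times> nat" where
  "path_vertex u 0 = Inl u"
| "path_vertex u (Suc i) = Inr (i, 0)"

definition path_edge :: "nat \<Rightarrow> 'a \<Rightarrow> nat \<Rightarrow> ('a + nat \<times> nat) set" where
  "path_edge k u i = insert (path_vertex u i) ((\<lambda>j. Inr (i, j)) ` {..<k - 1})"

definition attach_path :: "nat \<Rightarrow> 'a hypergraph \<Rightarrow> 'a \<Rightarrow> nat \<Rightarrow> ('a + nat \<times> nat) hypergraph" where
  "attach_path k G u p =
     \<lparr>verts = Inl ` verts G \<union> Inr ` ({..<p} \<times> {..<k - 1}),
      edges = (`) Inl ` edges G \<union> path_edge k u ` {..<p}\<rparr>"

text \<open>The hypergraph \<open>G\<^bsub>u,v\<^esub>(p, q)\<close>, where \<open>p\<close> or \<open>q\<close> may be zero.\<close>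

definition attach_two_paths ::
  "nat \<Rightarrow> 'a hypergraph \<Rightarrow> 'a \<Rightarrow> 'a \<Rightarrow> nat \<Rightarrow> nat \<Rightarrow> (('a + nat \<times> nat) + nat \<times> nat) hypergraph" where
  "attach_two_paths k G u v p q = attach_path k (attach_path k G u p) (Inl v) q"

lemma card_path_edge:
  assumes "2 \<le> k"
  shows "card (path_edge k u i) = k"
proof -
  have "path_vertex u i \<notin> (\<lambda>j. Inr (i, j)) ` {..<k - 1}"
    by (cases i) auto
  moreover have "inj_on (\<lambda>j. Inr (i, j) :: 'a + nat \<times> nat) {..<k - 1}"
    by (auto simp: inj_on_def)
  ultimately show ?thesis
    using assms by (simp add: path_edge_def card_image)
qed

lemma path_edge_Int_path_edge_Suc:
  assumes "2 \<le> k"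
  shows "path_edge k u i \<inter> path_edge k u (Suc i) = {path_vertex u (Suc i)}"
  using assms by (cases i) (auto simp: path_edge_def)

end

theory Submission
  imports "HOL-Analysis.Function_Topology" Defs
begin

text \<open>Let \<open>x\<close> be the Perron vector of the distance matrix of \<open>G\<^bsub>u,v\<^esub>(p, q)\<close>. The \<open>u\<close>-path, \<open>e\<close> and the
  \<open>v\<close>-path form one long path \<open>P\<close>, and the rest of \<open>G\<close> hangs off \<open>e\<close> in \<open>k\<close> parts. Passing to
  \<open>G\<^bsub>u,v\<^esub>(p - 1, q + 1)\<close> slides these parts along \<open>P\<close> by one edge, away from the \<open>v\<close>-path; only
  distances between \<open>P\<close> and the hanging parts change. With \<open>L\<close> and \<open>R\<close> the total \<open>x\<close>-weight of the
  \<open>u\<close>-path and the \<open>v\<close>-path (including \<open>u\<close> and \<open>v\<close>), a vertex hanging at \<open>v\<close> contributes exactly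
  \<open>2 (R - L)\<close> times its weight to the change of the quadratic form, and a vertex hanging elsewhere
  contributes more. So for \<open>L < R\<close> the Rayleigh quotient increases, for \<open>R < L\<close> the opposite move
  increases it, and for \<open>L = R\<close> any hanging vertex decides which of the two moves works.\<close>

section \<open>The Rayleigh quotient\<close>

text \<open>The form attains its maximum on the unit sphere by compactness, and homogeneity of
  degree 2 extends the bound to every \<open>y\<close>. The sphere lives in the product topology
  over \<open>V\<close>, whose points are the extensional functions, because the index set is an
  arbitrary finite set.\<close>

lemma quadratic_form_maximum:
  fixes M :: "'b \<Rightarrow> 'b \<Rightarrow> real"
  assumes "finite V" "V \<noteq> {}"
  obtains x l where "\<exists>u\<in>V. x u \<noteq> 0"
    "(\<Sum>u\<in>V. \<Sum>v\<in>V. M u v * x u * x v) = l * (\<Sum>u\<in>V. (x u)\<^sup>2)"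
    "\<And>y. (\<Sum>u\<in>V. \<Sum>v\<in>V. M u v * y u * y v) \<le> l * (\<Sum>u\<in>V. (y u)\<^sup>2)"
proof -
  define Q where "Q y = (\<Sum>u\<in>V. \<Sum>v\<in>V. M u v * y u * y v)" for y
  define N where "N y = (\<Sum>u\<in>V. (y u)\<^sup>2)" for y :: "'b \<Rightarrow> real"
  let ?X = "product_topology (\<lambda>_. euclideanreal) V"
  \<comment> \<open>The box is compact as a product of compact intervals; it contains the unit
    sphere, so \<open>S\<close>, which is closed in it, is exactly the sphere.\<close>
  define K where "K = (PiE V (\<lambda>_. {-1..1::real}))"
  define S where "S = K \<inter> {y \<in> topspace ?X. N y \<in> {1}}"
  have proj: "continuous_map ?X euclideanreal (\<lambda>y. y u)" if "u \<in> V" for u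
    using that by (rule continuous_map_product_projection)
  have contQ: "continuous_map ?X euclideanreal Q"
    unfolding Q_def using assms(1) by (intro continuous_intros proj) auto
  have contN: "continuous_map ?X euclideanreal N"
    unfolding N_def power2_eq_square using assms(1) by (intro continuous_intros proj) auto
  have "compactin ?X K"
    unfolding K_def compactin_PiE by simp
  moreover have "closedin ?X {y \<in> topspace ?X. N y \<in> {1}}"
    by (rule closedin_continuous_map_preimage[OF contN]) simp
  ultimately have "compactin ?X S"
    unfolding S_def by (metis closed_Int_compactin inf_commute)
  then have "compactin euclideanreal (Q ` S)"
    by (rule image_compactin[OF _ contQ])
  then have comp: "compact (Q ` S)" by simp
  obtain a where a: "a \<in> V" using assms(2) by blast
  have S_iff: "y \<in> S \<longleftrightarrow> y \<in> extensional V \<and> N y = 1" for y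
  proof
    assume y: "y \<in> extensional V \<and> N y = 1"
    have "\<bar>y u\<bar> \<le> 1" if "u \<in> V" for u
    proof -
      have "(y u)\<^sup>2 \<le> N y" unfolding N_def using that assms(1) by (intro member_le_sum) auto
      then show ?thesis using y by (simp add: abs_square_le_1)
    qed
    then show "y \<in> S" using y by (auto simp: S_def K_def PiE_iff abs_le_iff minus_le_iff)
  qed (auto simp: S_def K_def PiE_iff)
  have "(\<lambda>u\<in>V. if u = a then 1 else 0) \<in> S"
    using a assms(1) by (simp add: S_iff N_def if_distrib[of "\<lambda>x. x\<^sup>2"] cong: if_cong sum.cong)
  then have "Q ` S \<noteq> {}" by blast
  then obtain x where x: "x \<in> S" "\<And>y. y \<in> S \<Longrightarrow> Q y \<le> Q x"
    using compact_attains_sup[OF comp] by blast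
  have Nx: "N x = 1" using x(1) S_iff by blast
  have bound: "Q y \<le> Q x * N y" for y
  proof (cases "N y = 0")
    case True
    then have "y u = 0" if "u \<in> V" for u
      using that assms(1) by (simp add: N_def sum_nonneg_eq_0_iff)
    then have "Q y = 0" by (simp add: Q_def)
    then show ?thesis using True by simp
  next
    case False
    moreover have "N y \<ge> 0" by (simp add: N_def sum_nonneg)
    ultimately have pos: "N y > 0" by simp
    \<comment> \<open>Scaling by \<open>c\<close> puts \<open>y\<close> on the sphere; restricting
      to \<open>V\<close> makes the scaled vector extensional.\<close>
    define c where "c = inverse (sqrt (N y))"
    have c2: "c * c = inverse (N y)" using pos by (simp add: c_def flip: inverse_mult_distrib)
    define z where "z = (\<lambda>u\<in>V. c * y u)"
    have "N z = (c * c) * N y"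
      unfolding N_def sum_distrib_left by (rule sum.cong) (auto simp: z_def power2_eq_square)
    then have "z \<in> S" using pos c2 by (auto simp: S_iff z_def)
    moreover have "Q z = (c * c) * Q y"
      unfolding Q_def sum_distrib_left by (intro sum.cong) (auto simp: z_def)
    ultimately have "N y * Q z = Q y" "Q z \<le> Q x" using x(2)[of z] pos c2 by (simp_all add: field_simps)
    then show ?thesis using pos by (metis mult.commute mult_left_mono less_imp_le)
  qed
  have "\<exists>u\<in>V. x u \<noteq> 0"
  proof (rule ccontr)
    assume "\<not> ?thesis"
    then have "N x = 0" by (simp add: N_def)
    then show False using Nx by simp
  qed
  then show thesis using bound Nx unfolding Q_def N_def
    by (intro that[of x "\<Sum>u\<in>V. \<Sum>v\<in>V. M u v * x u * x v"]) auto
qed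

text \<open>First-order condition: moving \<open>x\<close> by \<open>t\<close> in the coordinate
  direction \<open>a\<close> gives a quadratic polynomial in \<open>t\<close> that is never positive
  and vanishes at 0, so its linear coefficient is zero. By symmetry of \<open>M\<close> this
  coefficient is twice the defect \<open>g\<close> of the eigenvalue equation at
  \<open>a\<close>.\<close>

lemma quadratic_form_maximizer_eigenvector:
  fixes M :: "'b \<Rightarrow> 'b \<Rightarrow> real"
  assumes fin: "finite V"
    and sym: "\<And>u v. u \<in> V \<Longrightarrow> v \<in> V \<Longrightarrow> M u v = M v u"
    and eq: "(\<Sum>u\<in>V. \<Sum>v\<in>V. M u v * x u * x v) = l * (\<Sum>u\<in>V. (x u)\<^sup>2)"
    and le: "\<And>y. (\<Sum>u\<in>V. \<Sum>v\<in>V. M u v * y u * y v) \<le> l * (\<Sum>u\<in>V. (y u)\<^sup>2)"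
    and a: "a \<in> V"
  shows "(\<Sum>v\<in>V. M a v * x v) = l * x a"
proof -
  define g where "g = (\<Sum>v\<in>V. M a v * x v) - l * x a"
  define e where "e u = (if u = a then 1 else 0 :: real)" for u
  have sum_e: "(\<Sum>u\<in>V. f u * e u) = f a" for f
  proof -
    have "(\<Sum>u\<in>V. f u * e u) = (\<Sum>u\<in>V. if u = a then f u else 0)"
      by (rule sum.cong) (auto simp: e_def)
    then show ?thesis using fin a by simp
  qed
  have *: "2 * t * g + t\<^sup>2 * (M a a - l) \<le> 0" for t
  proof -
    have "(\<Sum>u\<in>V. \<Sum>v\<in>V. M u v * (x u + t * e u) * (x v + t * e v))
        = (\<Sum>u\<in>V. \<Sum>v\<in>V. M u v * x u * x v) + t * (\<Sum>u\<in>V. (\<Sum>v\<in>V. M u v * x v) * e u)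
          + t * (\<Sum>u\<in>V. x u * (\<Sum>v\<in>V. M u v * e v)) + t\<^sup>2 * (\<Sum>u\<in>V. (\<Sum>v\<in>V. M u v * e v) * e u)"
      by (simp add: algebra_simps sum.distrib sum_distrib_left sum_distrib_right power2_eq_square)
    also have "\<dots> = l * (\<Sum>u\<in>V. (x u)\<^sup>2) + t * (\<Sum>v\<in>V. M a v * x v)
          + t * (\<Sum>u\<in>V. x u * M u a) + t\<^sup>2 * M a a"
      by (simp only: sum_e eq)
    also have "(\<Sum>u\<in>V. x u * M u a) = (\<Sum>v\<in>V. M a v * x v)"
      by (rule sum.cong) (auto simp: sym[OF _ a])
    finally have 1: "(\<Sum>u\<in>V. \<Sum>v\<in>V. M u v * (x u + t * e u) * (x v + t * e v))
      = l * (\<Sum>u\<in>V. (x u)\<^sup>2) + 2 * t * (\<Sum>v\<in>V. M a v * x v) + t\<^sup>2 * M a a" by simp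
    have "(\<Sum>u\<in>V. (x u + t * e u)\<^sup>2)
        = (\<Sum>u\<in>V. (x u)\<^sup>2) + 2 * t * (\<Sum>u\<in>V. x u * e u) + t\<^sup>2 * (\<Sum>u\<in>V. e u * e u)"
      by (simp add: algebra_simps sum.distrib sum_distrib_left power2_eq_square)
    also have "\<dots> = (\<Sum>u\<in>V. (x u)\<^sup>2) + 2 * t * x a + t\<^sup>2"
      by (simp only: sum_e) (simp add: e_def)
    finally have 2: "(\<Sum>u\<in>V. (x u + t * e u)\<^sup>2) = (\<Sum>u\<in>V. (x u)\<^sup>2) + 2 * t * x a + t\<^sup>2" .
    show ?thesis using le[of "\<lambda>u. x u + t * e u"] unfolding 1 2 g_def
      by (simp add: algebra_simps)
  qed
  have "g = 0"
  proof (rule ccontr)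
    assume "g \<noteq> 0"
    \<comment> \<open>At \<open>t = g / b\<close> the linear term is \<open>2 * (g * g / b)\<close>,
      while the quadratic one is at least \<open>- (g * g / b)\<close>, because \<open>b\<close>
      exceeds the modulus of its coefficient. What remains is
      \<open>g * g / b \<le> 0\<close>.\<close>
    define b where "b = \<bar>M a a - l\<bar> + 1"
    have b: "b > 0" "M a a - l \<ge> - b" by (auto simp: b_def)
    have "2 * (g / b) * g + (g / b)\<^sup>2 * (M a a - l) \<le> 0" by (rule *)
    moreover have "(g / b)\<^sup>2 * (- b) \<le> (g / b)\<^sup>2 * (M a a - l)"
      using b by (intro mult_left_mono) auto
    moreover have "(g / b)\<^sup>2 * (- b) = - (g * g / b)" "2 * (g / b) * g = 2 * (g * g / b)"
      using b by (simp_all add: power2_eq_square field_simps)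
    ultimately have "g * g / b \<le> 0" by linarith
    then show False using \<open>g \<noteq> 0\<close> b by (auto simp: divide_le_0_iff mult_le_0_iff)
  qed
  then show ?thesis by (simp add: g_def)
qed

text \<open>Taking absolute values of a maximizer does not decrease a form with nonnegative entries,
  so the result is again a maximizer and hence an eigenvector. Only off-diagonal entries need to be
  positive, which suits distance matrices.\<close>

lemma Perron_vector:
  fixes M :: "'b \<Rightarrow> 'b \<Rightarrow> real"
  assumes fin: "finite V" and ne: "V \<noteq> {}"
    and sym: "\<And>u v. u \<in> V \<Longrightarrow> v \<in> V \<Longrightarrow> M u v = M v u"
    and nonneg: "\<And>u v. u \<in> V \<Longrightarrow> v \<in> V \<Longrightarrow> M u v \<ge> 0"
    and pos: "\<And>u v. u \<in> V \<Longrightarrow> v \<in> V \<Longrightarrow> u \<noteq> v \<Longrightarrow> M u v > 0"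
  obtains x l where "\<And>u. u \<in> V \<Longrightarrow> x u > 0"
    "\<And>u. u \<in> V \<Longrightarrow> (\<Sum>v\<in>V. M u v * x v) = l * x u"
    "\<And>y. (\<Sum>u\<in>V. \<Sum>v\<in>V. M u v * y u * y v) \<le> l * (\<Sum>u\<in>V. (y u)\<^sup>2)"
proof -
  obtain w l where w: "\<exists>u\<in>V. w u \<noteq> 0"
    "(\<Sum>u\<in>V. \<Sum>v\<in>V. M u v * w u * w v) = l * (\<Sum>u\<in>V. (w u)\<^sup>2)"
    "\<And>y. (\<Sum>u\<in>V. \<Sum>v\<in>V. M u v * y u * y v) \<le> l * (\<Sum>u\<in>V. (y u)\<^sup>2)"
    using quadratic_form_maximum[OF fin ne, of M] by blast
  define x where "x u = \<bar>w u\<bar>" for u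
  have "(\<Sum>u\<in>V. \<Sum>v\<in>V. M u v * w u * w v) \<le> (\<Sum>u\<in>V. \<Sum>v\<in>V. M u v * x u * x v)"
    unfolding x_def mult.assoc abs_mult[symmetric]
    by (intro sum_mono mult_left_mono nonneg abs_ge_self)
  moreover have "(\<Sum>u\<in>V. (w u)\<^sup>2) = (\<Sum>u\<in>V. (x u)\<^sup>2)" by (simp add: x_def)
  ultimately have "(\<Sum>u\<in>V. \<Sum>v\<in>V. M u v * x u * x v) = l * (\<Sum>u\<in>V. (x u)\<^sup>2)"
    using w(2) w(3)[of x] by simp
  then have ev: "(\<Sum>v\<in>V. M u v * x v) = l * x u" if "u \<in> V" for u
    using quadratic_form_maximizer_eigenvector[OF fin sym _ w(3) that] by blast
  \<comment> \<open>A zero at \<open>u\<close> makes the eigenvalue equation at \<open>u\<close> a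
    vanishing sum of nonnegative terms; positive off-diagonal entries then force \<open>x\<close> to
    vanish everywhere.\<close>
  have "x u > 0" if u: "u \<in> V" for u
  proof (rule ccontr)
    assume "\<not> x u > 0"
    then have "x u = 0" by (simp add: x_def)
    then have "(\<Sum>v\<in>V. M u v * x v) = 0" using ev[OF u] by simp
    then have zero: "M u v * x v = 0" if "v \<in> V" for v
      using that fin u by (subst (asm) sum_nonneg_eq_0_iff) (auto simp: x_def intro!: mult_nonneg_nonneg nonneg)
    have "x v = 0" if "v \<in> V" for v
      using zero[OF that] pos[OF u that] \<open>x u = 0\<close> by (cases "u = v") auto
    then show False using w(1) by (auto simp: x_def)
  qed
  then show thesis using ev w(3) by (rule that)
qed

text \<open>Meant for the change of the distance form under a slide: it vanishes within the hanging
  parts and within the long path, and only the mixed terms survive.\<close>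

lemma sum_two_blocks:
  fixes F :: "'b \<Rightarrow> 'b \<Rightarrow> real"
  assumes "finite S" "finite T" "S \<inter> T = {}"
    and sym: "\<And>y z. F y z = F z y"
    and S: "\<And>y z. y \<in> S \<Longrightarrow> z \<in> S \<Longrightarrow> F y z = 0"
    and T: "\<And>y z. y \<in> T \<Longrightarrow> z \<in> T \<Longrightarrow> F y z = 0"
  shows "(\<Sum>y\<in>S \<union> T. \<Sum>z\<in>S \<union> T. F y z) = 2 * (\<Sum>y\<in>S. \<Sum>z\<in>T. F y z)"
proof -
  have "(\<Sum>y\<in>T. \<Sum>z\<in>S. F y z) = (\<Sum>y\<in>S. \<Sum>z\<in>T. F y z)"
    by (subst sum.swap) (simp add: sym)
  moreover have "(\<Sum>y\<in>S. \<Sum>z\<in>S. F y z) = 0" "(\<Sum>y\<in>T. \<Sum>z\<in>T. F y z) = 0"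
    by (simp_all add: S T)
  ultimately show ?thesis
    using assms(1-3) by (simp add: sum.union_disjoint sum.distrib)
qed

section \<open>Distances in hypergraphs\<close>

text \<open>Local characterisation of the distance from \<open>a\<close>: the Lipschitz condition bounds the distance
  from below, and descending neighbours bound it from above.\<close>

definition distance_from :: "'a hypergraph \<Rightarrow> 'a \<Rightarrow> ('a \<Rightarrow> nat) \<Rightarrow> bool" where
  "distance_from G a f \<longleftrightarrow> a \<in> verts G \<and> f a = 0 \<and> (\<forall>v\<in>verts G. f v = 0 \<longrightarrow> v = a) \<and>
     (\<forall>e\<in>edges G. \<forall>x\<in>e. \<forall>y\<in>e. f x \<le> f y + 1) \<and>
     (\<forall>v\<in>verts G. f v > 0 \<longrightarrow> (\<exists>e\<in>edges G. \<exists>w\<in>verts G. v \<in> e \<and> w \<in> e \<and> f w < f v))"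

lemma walk_Lipschitz:
  assumes "walk G vs es"
    and "\<And>e x y. e \<in> edges G \<Longrightarrow> x \<in> e \<Longrightarrow> y \<in> e \<Longrightarrow> f x \<le> f y + (1::nat)"
    and "i < length vs"
  shows "f (vs ! i) \<le> f (vs ! 0) + i"
  using assms(3)
proof (induction i)
  case (Suc i)
  then have "i < length es" using assms(1) by (simp add: walk_def)
  then have "f (vs ! Suc i) \<le> f (vs ! i) + 1"
    using assms(1) by (intro assms(2)[of "es ! i"]) (auto simp: walk_def)
  then show ?case using Suc by simp
qed simp

lemma hpath_length_ge:
  assumes f: "distance_from G a f" and p: "hpath G a vs es v"
  shows "f v \<le> length es"
proof -
  have w: "walk G vs es" and ne: "vs \<noteq> []" and len: "length vs = Suc (length es)"
    using p by (auto simp: hpath_def walk_def)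
  have "f (vs ! length es) \<le> f (vs ! 0) + length es"
    using f len by (intro walk_Lipschitz[OF w]) (auto simp: distance_from_def)
  moreover have "vs ! 0 = a" "vs ! length es = v"
    using p ne len by (auto simp: hpath_def hd_conv_nth last_conv_nth)
  ultimately show ?thesis using f by (simp add: distance_from_def)
qed

text \<open>Along a shortest path \<open>f\<close> takes the values \<open>0, 1, 2, \<dots>\<close>; since \<open>f\<close> varies by at most \<open>1\<close> on an
  edge, neither a vertex nor an edge can be repeated.\<close>

lemma distance_from_walk:
  assumes f: "distance_from G a f" and v: "v \<in> verts G"
  shows "\<exists>vs es. walk G vs es \<and> hd vs = a \<and> last vs = v \<and> length es = f v \<and>
    (\<forall>i<length vs. f (vs ! i) = i)"
  using v
proof (induction "f v" arbitrary: v)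
  case 0
  then have "v = a" using f by (auto simp: distance_from_def)
  then show ?case using 0 by (intro exI[of _ "[a]"] exI[of _ "[]"]) (auto simp: walk_def)
next
  case (Suc n)
  then obtain e w where w: "e \<in> edges G" "w \<in> verts G" "v \<in> e" "w \<in> e" "f w < f v"
    using f unfolding distance_from_def by (metis zero_less_Suc)
  then have "f v \<le> f w + 1" using f by (auto simp: distance_from_def)
  then have fw: "f w = n" using w Suc(2) by simp
  obtain vs es where ih: "walk G vs es" "hd vs = a" "last vs = w" "length es = f w"
      "\<forall>i<length vs. f (vs ! i) = i"
    using Suc(1)[of w] fw w by blast
  have len: "length vs = Suc n" using ih fw by (simp add: walk_def)
  then have ne: "vs \<noteq> []" by auto
  have nth: "vs ! n = w" using ih(3) len ne by (simp add: last_conv_nth)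
  have "walk G (vs @ [v]) (es @ [e])"
    unfolding walk_def
  proof (intro conjI allI impI)
    fix i assume i: "i < length (es @ [e])"
    consider "i < n" | "i = n" using i ih(4) fw by fastforce
    then have "(es @ [e]) ! i \<in> edges G \<and> (vs @ [v]) ! i \<in> (es @ [e]) ! i \<and>
        (vs @ [v]) ! Suc i \<in> (es @ [e]) ! i \<and> (vs @ [v]) ! i \<noteq> (vs @ [v]) ! Suc i"
    proof cases
      case 1 then show ?thesis using ih(1,4) fw len by (simp add: walk_def nth_append)
    next
      case 2 then show ?thesis using ih(4) fw len nth w by (auto simp: nth_append)
    qed
    then show "(es @ [e]) ! i \<in> edges G" "(vs @ [v]) ! i \<in> (es @ [e]) ! i"
      "(vs @ [v]) ! Suc i \<in> (es @ [e]) ! i" "(vs @ [v]) ! i \<noteq> (vs @ [v]) ! Suc i" by auto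
  qed (use ih Suc w in \<open>auto simp: walk_def\<close>)
  moreover have "\<forall>i<length (vs @ [v]). f ((vs @ [v]) ! i) = i"
    using ih(5) len Suc(2) by (auto simp: nth_append less_Suc_eq)
  ultimately show ?case using ih ne fw Suc(2)
    by (intro exI[of _ "vs @ [v]"] exI[of _ "es @ [e]"]) simp
qed

lemma distance_from_hpath:
  assumes f: "distance_from G a f" and v: "v \<in> verts G"
  shows "\<exists>vs es. hpath G a vs es v \<and> length es = f v"
proof -
  obtain vs es where w: "walk G vs es" "hd vs = a" "last vs = v" "length es = f v"
    "\<And>i. i < length vs \<Longrightarrow> f (vs ! i) = i"
    using distance_from_walk[OF assms] by blast
  have len: "length vs = Suc (length es)" using w(1) by (simp add: walk_def)
  have "distinct vs"
    unfolding distinct_conv_nth using w(5) by metis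
  moreover have "es ! i \<noteq> es ! j" if "i < j" "j < length es" for i j
  proof
    assume eq: "es ! i = es ! j"
    \<comment> \<open>A repeated edge would contain the start of its first and the end of its second
      use, where \<open>f\<close> differs by \<open>j + 1 - i\<close>, which is at least 2.\<close>
    have "vs ! i \<in> es ! j" "vs ! Suc j \<in> es ! j" "es ! j \<in> edges G"
      using w(1) that eq by (auto simp: walk_def)
    then have "f (vs ! Suc j) \<le> f (vs ! i) + 1" using f by (auto simp: distance_from_def)
    then show False using w(5)[of i] w(5)[of "Suc j"] that len by simp
  qed
  then have "distinct es" unfolding distinct_conv_nth by (metis linorder_neqE_nat)
  ultimately show ?thesis using w by (auto simp: hpath_def)
qed

text \<open>Turns every distance computation below into guessing a function and checking local
  conditions on edges.\<close>

lemma hdist_eqI: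
  assumes f: "distance_from G a f" and v: "v \<in> verts G"
  shows "hdist G a v = f v"
  unfolding hdist_def
  using distance_from_hpath[OF assms] hpath_length_ge[OF f] by (intro Least_equality) blast+

section \<open>Reachability along edges and existence of the distance function\<close>

definition adjacency :: "'a hypergraph \<Rightarrow> ('a \<times> 'a) set" where
  "adjacency G = {(x, y). \<exists>e\<in>edges G. x \<in> e \<and> y \<in> e}"

lemma adjacencyI: "e \<in> edges G \<Longrightarrow> x \<in> e \<Longrightarrow> y \<in> e \<Longrightarrow> (x, y) \<in> adjacency G"
  by (auto simp: adjacency_def)

lemma sym_adjacency: "sym (adjacency G)"
  by (auto simp: adjacency_def sym_def)

lemma hpath_imp_rtrancl_adjacency:
  assumes "hpath G a vs es v"
  shows "(a, v) \<in> (adjacency G)\<^sup>*"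
proof -
  have len: "length vs = Suc (length es)" using assms by (auto simp: hpath_def walk_def)
  have "(vs ! 0, vs ! i) \<in> (adjacency G)\<^sup>*" if "i \<le> length es" for i
    using that
  proof (induction i)
    case (Suc i)
    then have "(vs ! i, vs ! Suc i) \<in> adjacency G"
      using assms by (auto simp: hpath_def walk_def intro!: adjacencyI[of "es ! i"])
    then show ?case using Suc by (meson Suc_leD rtrancl.rtrancl_into_rtrancl)
  qed simp
  moreover have "vs ! 0 = a" "vs ! length es = v"
    using assms len by (auto simp: hpath_def hd_conv_nth last_conv_nth simp flip: length_0_conv)
  ultimately show ?thesis by auto
qed

text \<open>The least length of an adjacency chain from \<open>a\<close> works: extending a chain by
  one link gives the Lipschitz condition, and the penultimate vertex of a shortest chain is the
  descending neighbour.\<close>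

lemma ex_distance_from:
  assumes G: "hypergraph G" and a: "a \<in> verts G"
    and reach: "\<And>v. v \<in> verts G \<Longrightarrow> (a, v) \<in> (adjacency G)\<^sup>*"
  shows "\<exists>f. distance_from G a f"
proof -
  define f where "f v = (LEAST n. (a, v) \<in> adjacency G ^^ n)" for v
  have f: "(a, v) \<in> adjacency G ^^ f v" if "v \<in> verts G" for v
    unfolding f_def using rtrancl_imp_relpow[OF reach[OF that]] by (auto intro: LeastI)
  have le: "f v \<le> n" if "(a, v) \<in> adjacency G ^^ n" for v n
    unfolding f_def using that by (rule Least_le)
  have "f a = 0" using le[of a 0] by simp
  moreover have "f x \<le> f y + 1" if "e \<in> edges G" "x \<in> e" "y \<in> e" for e x y
  proof -
    have "y \<in> verts G" using G that by (auto simp: hypergraph_def)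
    then have "(a, x) \<in> adjacency G ^^ Suc (f y)"
      using f adjacencyI[of e G y x] that by (auto intro: relpow_Suc_I)
    then show ?thesis using le by fastforce
  qed
  moreover have "\<exists>e\<in>edges G. \<exists>w\<in>verts G. v \<in> e \<and> w \<in> e \<and> f w < f v"
    if v: "v \<in> verts G" "f v > 0" for v
  proof -
    obtain n where n: "f v = Suc n" using v by (cases "f v") auto
    then obtain w where w: "(a, w) \<in> adjacency G ^^ n" "(w, v) \<in> adjacency G"
      using f[OF v(1)] by auto
    then have "f w < f v" using le[OF w(1)] n by simp
    then show ?thesis using w(2) G by (auto simp: adjacency_def hypergraph_def)
  qed
  moreover have "v = a" if "v \<in> verts G" "f v = 0" for v
    using f[OF that(1)] that(2) by simp
  ultimately show ?thesis using a unfolding distance_from_def by blast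
qed

lemma distance_from_hdist:
  assumes G: "hypergraph G" and con: "hconnected G" and a: "a \<in> verts G"
  shows "distance_from G a (hdist G a)"
proof -
  have "(a, v) \<in> (adjacency G)\<^sup>*" if "v \<in> verts G" for v
    using con a that hpath_imp_rtrancl_adjacency unfolding hconnected_def by metis
  then obtain f where f: "distance_from G a f" using ex_distance_from[OF G a] by blast
  have eq: "hdist G a v = f v" if "v \<in> verts G" for v by (rule hdist_eqI[OF f that])
  have "e \<subseteq> verts G" if "e \<in> edges G" for e using G that by (auto simp: hypergraph_def)
  then show ?thesis using f unfolding distance_from_def by (simp add: eq subset_iff)
qed

lemma hconnectedI:
  assumes "\<And>a. a \<in> verts G \<Longrightarrow> \<exists>f. distance_from G a f"
  shows "hconnected G"
  unfolding hconnected_def using assms distance_from_hpath by metis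

lemma hpath_rev:
  assumes "hpath G a vs es v"
  shows "hpath G v (rev vs) (rev es) a"
proof -
  have w: "walk G vs es" and len: "length vs = Suc (length es)"
    using assms by (auto simp: hpath_def walk_def)
  have "walk G (rev vs) (rev es)"
    unfolding walk_def
  proof (intro conjI allI impI)
    fix i assume i: "i < length (rev es)"
    define j where "j = length es - Suc i"
    have j: "rev es ! i = es ! j" "rev vs ! i = vs ! Suc j" "rev vs ! Suc i = vs ! j" "j < length es"
      using i len by (auto simp: j_def rev_nth Suc_diff_Suc)
    show "rev es ! i \<in> edges G" "rev vs ! i \<in> rev es ! i" "rev vs ! Suc i \<in> rev es ! i"
      "rev vs ! i \<noteq> rev vs ! Suc i"
      using w j(4) unfolding j(1-3) by (auto simp: walk_def)
  qed (use w in \<open>auto simp: walk_def\<close>)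
  then show ?thesis using assms len
    by (auto simp: hpath_def hd_rev last_rev)
qed

lemma hdist_commute: "hdist G a v = hdist G v a"
proof -
  have "(\<exists>vs es. hpath G a vs es v \<and> length es = n) = (\<exists>vs es. hpath G v vs es a \<and> length es = n)" for n
    by (metis hpath_rev length_rev)
  then show ?thesis by (simp add: hdist_def)
qed

section \<open>Metric properties of a connected hypergraph\<close>

context
  fixes G :: "'a hypergraph"
  assumes G: "hypergraph G" "hconnected G"
begin

lemma hdist_self: "a \<in> verts G \<Longrightarrow> hdist G a a = 0"
  using distance_from_hdist[OF G] by (simp add: distance_from_def)

lemma hdist_eq_0_iff: "a \<in> verts G \<Longrightarrow> b \<in> verts G \<Longrightarrow> hdist G a b = 0 \<longleftrightarrow> a = b"
  using distance_from_hdist[OF G, of a] by (auto simp: distance_from_def)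

lemma hdist_edge_le:
  "a \<in> verts G \<Longrightarrow> e \<in> edges G \<Longrightarrow> x \<in> e \<Longrightarrow> y \<in> e \<Longrightarrow> hdist G a x \<le> hdist G a y + 1"
  using distance_from_hdist[OF G] by (simp add: distance_from_def)

lemma hdist_descend:
  assumes "a \<in> verts G" "v \<in> verts G" "a \<noteq> v"
  obtains e w where "e \<in> edges G" "w \<in> verts G" "v \<in> e" "w \<in> e" "hdist G a w < hdist G a v"
  using distance_from_hdist[OF G assms(1)] assms unfolding distance_from_def by (metis gr0I)

lemma hdist_edge:
  assumes "e \<in> edges G" "x \<in> e" "y \<in> e"
  shows "hdist G x y = (if x = y then 0 else 1)"
proof -
  have "x \<in> verts G" "y \<in> verts G" using assms G(1) by (auto simp: hypergraph_def)
  then show ?thesis using hdist_edge_le[OF _ assms(1,3,2), of x] hdist_self[of x] hdist_eq_0_iff[of x y]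
    by auto
qed

lemma hdist_triangle_edge:
  assumes "e \<in> edges G" "x \<in> e" "y \<in> e" "a \<in> verts G"
  shows "hdist G x a \<le> hdist G y a + 1"
  using hdist_edge_le[OF assms(4,1,2,3)] by (simp add: hdist_commute[of G a])

end

section \<open>The distance spectral radius as a Rayleigh quotient\<close>

text \<open>The eigenvalues are roots of the nonzero characteristic polynomial, so they form a
  finite set and \<open>Max\<close> is meaningful. The Rayleigh bound, evaluated at an eigenvector,
  dominates each of them, and \<open>x\<close> shows that \<open>l\<close> is attained.\<close>

lemma distance_spectral_radius_eqI:
  assumes G: "hypergraph G"
    and x: "\<And>u. u \<in> verts G \<Longrightarrow> x u > 0"
    and eig: "\<And>u. u \<in> verts G \<Longrightarrow> (\<Sum>v\<in>verts G. real (hdist G u v) * x v) = l * x u"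
    and max: "\<And>y. (\<Sum>u\<in>verts G. \<Sum>v\<in>verts G. real (hdist G u v) * y u * y v)
      \<le> l * (\<Sum>u\<in>verts G. (y u)\<^sup>2)"
  shows "distance_spectral_radius G = l"
proof -
  have fin: "finite (verts G)" and ne: "verts G \<noteq> {}" using G by (auto simp: hypergraph_def)
  let ?E = "{r. eigenvalue (distance_matrix G) r}"
  have "finite ?E"
  proof -
    have D: "distance_matrix G \<in> carrier_mat (card (verts G)) (card (verts G))"
      by (simp add: distance_matrix_def)
    have "char_poly (distance_matrix G) \<noteq> 0"
      using degree_monic_char_poly[OF D] by auto
    then show ?thesis
      unfolding eigenvalue_root_char_poly[OF D] by (rule poly_roots_finite)
  qed
  moreover have "l \<in> ?E"
  proof -
    obtain a where "a \<in> verts G" using ne by blast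
    then have "\<exists>u\<in>verts G. x u \<noteq> 0" using x[of a] by (intro bexI[of _ a]) auto
    then show ?thesis
      using eig unfolding mem_Collect_eq eigenvalue_distance_matrix_iff[OF fin] by blast
  qed
  moreover have "r \<le> l" if r: "r \<in> ?E" for r
  proof -
    obtain y where y: "\<exists>u\<in>verts G. y u \<noteq> 0"
      "\<And>u. u \<in> verts G \<Longrightarrow> (\<Sum>v\<in>verts G. real (hdist G u v) * y v) = r * y u"
      using r eigenvalue_distance_matrix_iff[OF fin, of r] by auto
    have "(\<Sum>u\<in>verts G. \<Sum>v\<in>verts G. real (hdist G u v) * y u * y v)
        = (\<Sum>u\<in>verts G. y u * (\<Sum>v\<in>verts G. real (hdist G u v) * y v))"
      by (simp add: sum_distrib_left mult_ac)
    also have "\<dots> = (\<Sum>u\<in>verts G. y u * (r * y u))" by (simp add: y(2))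
    also have "\<dots> = r * (\<Sum>u\<in>verts G. (y u)\<^sup>2)"
      by (simp add: sum_distrib_left power2_eq_square mult_ac)
    finally have "r * (\<Sum>u\<in>verts G. (y u)\<^sup>2) \<le> l * (\<Sum>u\<in>verts G. (y u)\<^sup>2)"
      using max[of y] by simp
    moreover have "(\<Sum>u\<in>verts G. (y u)\<^sup>2) > 0"
      using y(1) fin by (auto intro: sum_pos2)
    ultimately show ?thesis by simp
  qed
  ultimately show ?thesis unfolding distance_spectral_radius_def by (intro Max_eqI) auto
qed

lemma distance_Perron_vector:
  assumes G: "hypergraph G" "hconnected G"
  obtains x where "\<And>u. u \<in> verts G \<Longrightarrow> x u > 0"
    "\<And>u. u \<in> verts G \<Longrightarrow>
      (\<Sum>v\<in>verts G. real (hdist G u v) * x v) = distance_spectral_radius G * x u"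
    "\<And>y. (\<Sum>u\<in>verts G. \<Sum>v\<in>verts G. real (hdist G u v) * y u * y v)
      \<le> distance_spectral_radius G * (\<Sum>u\<in>verts G. (y u)\<^sup>2)"
proof -
  have fin: "finite (verts G)" and ne: "verts G \<noteq> {}" using G by (auto simp: hypergraph_def)
  have pos: "real (hdist G u v) > 0" if "u \<in> verts G" "v \<in> verts G" "u \<noteq> v" for u v
    using hdist_eq_0_iff[OF G that(1,2)] that by simp
  have sym: "real (hdist G u v) = real (hdist G v u)" for u v
    by (simp add: hdist_commute)
  obtain x l where x: "\<And>u. u \<in> verts G \<Longrightarrow> x u > 0"
    "\<And>u. u \<in> verts G \<Longrightarrow> (\<Sum>v\<in>verts G. real (hdist G u v) * x v) = l * x u"
    "\<And>y. (\<Sum>u\<in>verts G. \<Sum>v\<in>verts G. real (hdist G u v) * y u * y v)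
      \<le> l * (\<Sum>u\<in>verts G. (y u)\<^sup>2)"
    using Perron_vector[OF fin ne, of "\<lambda>u v. real (hdist G u v)"] sym pos by auto
  then have "distance_spectral_radius G = l" by (rule distance_spectral_radius_eqI[OF G(1)])
  with x show thesis using that by blast
qed

text \<open>The eigenvector of \<open>G\<close>, transported along \<open>f\<close>, serves as a
  test vector on \<open>H\<close>: its norm is unchanged and its quadratic form has grown, so its
  Rayleigh quotient on \<open>H\<close> exceeds \<open>l\<close>.\<close>

lemma distance_spectral_radius_lessI:
  assumes G: "hypergraph G" and H: "hypergraph H" "hconnected H"
    and bij: "bij_betw f (verts G) (verts H)"
    and x: "\<exists>u\<in>verts G. x u \<noteq> 0"
    and eig: "\<And>u. u \<in> verts G \<Longrightarrow> (\<Sum>v\<in>verts G. real (hdist G u v) * x v) = l * x u"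
    and pos: "(\<Sum>u\<in>verts G. \<Sum>v\<in>verts G.
      (real (hdist H (f u) (f v)) - real (hdist G u v)) * x u * x v) > 0"
  shows "l < distance_spectral_radius H"
proof -
  have fin: "finite (verts G)" using G by (auto simp: hypergraph_def)
  define y where "y = (\<lambda>w. x (the_inv_into (verts G) f w))"
  have y: "y (f u) = x u" if "u \<in> verts G" for u
    using that bij by (simp add: y_def bij_betw_def the_inv_into_f_f)
  obtain r where r: "distance_spectral_radius H = r"
    "\<And>y. (\<Sum>u\<in>verts H. \<Sum>v\<in>verts H. real (hdist H u v) * y u * y v)
      \<le> r * (\<Sum>u\<in>verts H. (y u)\<^sup>2)"
    using distance_Perron_vector[OF H] by metis
  have "l * (\<Sum>u\<in>verts G. (x u)\<^sup>2) = (\<Sum>u\<in>verts G. x u * (l * x u))"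
    by (simp add: sum_distrib_left power2_eq_square mult_ac)
  also have "\<dots> = (\<Sum>u\<in>verts G. x u * (\<Sum>v\<in>verts G. real (hdist G u v) * x v))"
    by (simp add: eig)
  also have "\<dots> = (\<Sum>u\<in>verts G. \<Sum>v\<in>verts G. real (hdist G u v) * x u * x v)"
    by (simp add: sum_distrib_left mult_ac)
  also have "\<dots> < (\<Sum>u\<in>verts G. \<Sum>v\<in>verts G. real (hdist H (f u) (f v)) * x u * x v)"
    using pos by (simp add: left_diff_distrib sum_subtractf)
  also have "\<dots> = (\<Sum>u\<in>verts G. \<Sum>v\<in>verts G. real (hdist H (f u) (f v)) * y (f u) * y (f v))"
    by (simp add: y)
  also have "\<dots> = (\<Sum>u\<in>verts G. \<Sum>v\<in>verts H. real (hdist H (f u) v) * y (f u) * y v)"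
    by (intro sum.cong refl sum.reindex_bij_betw[OF bij])
  also have "\<dots> = (\<Sum>u\<in>verts H. \<Sum>v\<in>verts H. real (hdist H u v) * y u * y v)"
    by (rule sum.reindex_bij_betw[OF bij])
  also have "\<dots> \<le> r * (\<Sum>u\<in>verts H. (y u)\<^sup>2)" by (rule r)
  also have "(\<Sum>u\<in>verts H. (y u)\<^sup>2) = (\<Sum>u\<in>verts G. (y (f u))\<^sup>2)"
    by (rule sum.reindex_bij_betw[OF bij, symmetric])
  also have "\<dots> = (\<Sum>u\<in>verts G. (x u)\<^sup>2)" by (simp add: y)
  finally have "l * (\<Sum>u\<in>verts G. (x u)\<^sup>2) < r * (\<Sum>u\<in>verts G. (x u)\<^sup>2)" .
  moreover have "(\<Sum>u\<in>verts G. (x u)\<^sup>2) > 0"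
    using x fin by (auto intro: sum_pos2)
  ultimately show ?thesis using r by simp
qed

lemma eigenvector_isometry:
  fixes x :: "'b \<Rightarrow> real"
  assumes bij: "bij_betw f (verts G) (verts H)"
    and iso: "\<And>y z. y \<in> verts G \<Longrightarrow> z \<in> verts G \<Longrightarrow> hdist H (f y) (f z) = hdist G y z"
    and eig: "\<And>y. y \<in> verts H \<Longrightarrow> (\<Sum>z\<in>verts H. real (hdist H y z) * x z) = l * x y"
    and y: "y \<in> verts G"
  shows "(\<Sum>z\<in>verts G. real (hdist G y z) * x (f z)) = l * x (f y)"
proof -
  have "(\<Sum>z\<in>verts G. real (hdist G y z) * x (f z)) = (\<Sum>z\<in>verts G. real (hdist H (f y) (f z)) * x (f z))"
    using iso y by simp
  also have "\<dots> = (\<Sum>z\<in>verts H. real (hdist H (f y) z) * x z)"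
    by (rule sum.reindex_bij_betw[OF bij])
  also have "\<dots> = l * x (f y)" using eig bij_betwE[OF bij] y by simp
  finally show ?thesis .
qed

text \<open>Needed because the two paths carry different tags: exchanging the roles of
  \<open>u\<close> and \<open>v\<close> yields an isometric hypergraph, not an equal one.\<close>

lemma distance_spectral_radius_isometry:
  assumes G: "hypergraph G" and H: "hypergraph H" "hconnected H"
    and bij: "bij_betw f (verts G) (verts H)"
    and iso: "\<And>y z. y \<in> verts G \<Longrightarrow> z \<in> verts G \<Longrightarrow> hdist H (f y) (f z) = hdist G y z"
  shows "distance_spectral_radius G = distance_spectral_radius H"
proof -
  let ?l = "distance_spectral_radius H"
  obtain x where x: "\<And>u. u \<in> verts H \<Longrightarrow> x u > 0"
    "\<And>u. u \<in> verts H \<Longrightarrow> (\<Sum>v\<in>verts H. real (hdist H u v) * x v) = ?l * x u"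
    "\<And>y. (\<Sum>u\<in>verts H. \<Sum>v\<in>verts H. real (hdist H u v) * y u * y v) \<le> ?l * (\<Sum>u\<in>verts H. (y u)\<^sup>2)"
    using distance_Perron_vector[OF H] by blast
  show ?thesis
  proof (rule distance_spectral_radius_eqI[OF G, of "\<lambda>z. x (f z)"])
    fix y :: "'a \<Rightarrow> real"
    define z where "z w = y (the_inv_into (verts G) f w)" for w
    have z: "z (f u) = y u" if "u \<in> verts G" for u
      using that bij by (simp add: z_def bij_betw_def the_inv_into_f_f)
    have "(\<Sum>u\<in>verts G. \<Sum>v\<in>verts G. real (hdist G u v) * y u * y v)
        = (\<Sum>u\<in>verts G. \<Sum>v\<in>verts G. real (hdist H (f u) (f v)) * z (f u) * z (f v))"
      using iso z by simp
    also have "\<dots> = (\<Sum>u\<in>verts G. \<Sum>v\<in>verts H. real (hdist H (f u) v) * z (f u) * z v)"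
      by (intro sum.cong refl sum.reindex_bij_betw[OF bij])
    also have "\<dots> = (\<Sum>u\<in>verts H. \<Sum>v\<in>verts H. real (hdist H u v) * z u * z v)"
      by (rule sum.reindex_bij_betw[OF bij])
    also have "\<dots> \<le> ?l * (\<Sum>u\<in>verts H. (z u)\<^sup>2)" by (rule x(3))
    also have "(\<Sum>u\<in>verts H. (z u)\<^sup>2) = (\<Sum>u\<in>verts G. (z (f u))\<^sup>2)"
      by (rule sum.reindex_bij_betw[OF bij, symmetric])
    also have "\<dots> = (\<Sum>u\<in>verts G. (y u)\<^sup>2)" by (simp add: z)
    finally show "(\<Sum>u\<in>verts G. \<Sum>v\<in>verts G. real (hdist G u v) * y u * y v)
      \<le> ?l * (\<Sum>u\<in>verts G. (y u)\<^sup>2)" .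
  next
    show "x (f u) > 0" if "u \<in> verts G" for u using x(1) bij_betwE[OF bij] that by blast
    show "(\<Sum>v\<in>verts G. real (hdist G u v) * x (f v)) = ?l * x (f u)" if "u \<in> verts G" for u
      by (rule eigenvector_isometry[OF bij iso x(2) that])
  qed
qed

text \<open>Combine the eigenvalue equations at \<open>u\<close>, \<open>w\<close> and
  \<open>z\<close> with coefficients 1, 2 and -1. Since \<open>z\<close> and \<open>u\<close> share
  an edge, the combined coefficient \<open>c t\<close> is at least
  \<open>2 * hdist G w t - 1\<close>, hence negative at most for \<open>t = w\<close>. This controls
  the only vertex of the \<open>u\<close>-path whose distance from a hanging vertex may shrink by
  2.\<close>

lemma Perron_vector_less:
  assumes G: "hypergraph G" "hconnected G"
    and x: "\<And>y. y \<in> verts G \<Longrightarrow> x y > 0"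
    and eig: "\<And>y. y \<in> verts G \<Longrightarrow> (\<Sum>t\<in>verts G. real (hdist G y t) * x t) = l * x y"
    and f: "f \<in> edges G" "z \<in> f" "u \<in> f" and e: "e \<in> edges G" "u \<in> e" "w \<in> e"
    and neq: "z \<noteq> u" "z \<noteq> w" "u \<noteq> w"
  shows "x z < x u + 2 * x w"
proof (rule ccontr)
  assume "\<not> x z < x u + 2 * x w"
  then have le: "x u + 2 * x w - x z \<le> 0" by simp
  have V: "z \<in> verts G" "u \<in> verts G" "w \<in> verts G" and fin: "finite (verts G)"
    using G f e by (auto simp: hypergraph_def)
  have "l * x u \<ge> 0" using x unfolding eig[OF V(2), symmetric] by (intro sum_nonneg mult_nonneg_nonneg) (auto intro: less_imp_le)
  then have "l \<ge> 0" using x[OF V(2)] by (simp add: zero_le_mult_iff)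
  define c where "c t = real (hdist G u t) + 2 * real (hdist G w t) - real (hdist G z t)" for t
  have c: "c t \<ge> (if t = w then - 1 else 1)" if t: "t \<in> verts G" for t
  proof -
    have 1: "hdist G z t \<le> hdist G u t + 1" by (rule hdist_triangle_edge[OF G f t])
    show ?thesis
    proof (cases "t = w")
      case True
      then show ?thesis using 1 hdist_edge[OF G e] by (simp add: c_def)
    next
      case False
      then have "hdist G w t > 0" using hdist_eq_0_iff[OF G V(3) t] by simp
      then show ?thesis using 1 False by (simp add: c_def)
    qed
  qed
  \<comment> \<open>All omitted terms have weight +1. The chain ends in
    \<open>x u + x z - x w \<le> 0\<close>, whereas the negated claim makes the left side at least
    \<open>2 * x u + x w\<close>, which is positive.\<close>
  have "x u + x z - x w = (\<Sum>t\<in>{u, z, w}. (if t = w then - 1 else 1) * x t)"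
    using neq by simp
  also have "\<dots> \<le> (\<Sum>t\<in>verts G. (if t = w then - 1 else 1) * x t)"
    using V fin x by (intro sum_mono2) (auto intro: less_imp_le)
  also have "\<dots> \<le> (\<Sum>t\<in>verts G. c t * x t)"
    using c x by (intro sum_mono mult_right_mono) (auto intro: less_imp_le)
  also have "\<dots> = (\<Sum>t\<in>verts G. real (hdist G u t) * x t)
      + 2 * (\<Sum>t\<in>verts G. real (hdist G w t) * x t) - (\<Sum>t\<in>verts G. real (hdist G z t) * x t)"
    by (simp add: c_def algebra_simps sum.distrib sum_subtractf sum_distrib_left)
  also have "\<dots> = l * (x u + 2 * x w - x z)"
    using eig V by (simp add: algebra_simps)
  also have "\<dots> \<le> 0" using le \<open>l \<ge> 0\<close> by (rule mult_nonneg_nonpos[rotated])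
  finally show False using le x[OF V(2)] x[OF V(3)] by linarith
qed

section \<open>Distances after attaching paths\<close>

text \<open>The new vertex \<open>Inr (i, j)\<close> has distance \<open>i + 1\<close> from the root. A path from it
  to a new vertex of a later edge starts through \<open>Inr (i, 0)\<close>, which costs one step unless \<open>j = 0\<close>.\<close>

fun path_dist :: "nat \<times> nat \<Rightarrow> nat \<times> nat \<Rightarrow> nat" where
  "path_dist (i, j) (i', j') =
     (if i = i' then (if j = j' then 0 else 1)
      else if i < i' then i' - i + (if j = 0 then 0 else 1)
      else i - i' + (if j' = 0 then 0 else 1))"

lemma hypergraph_attach_path:
  assumes k: "k \<ge> 2" and G: "hypergraph G" and u: "u \<in> verts G"
  shows "hypergraph (attach_path k G u p)"
proof -
  have "path_edge k u i \<subseteq> verts (attach_path k G u p)" if "i < p" for i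
    using that k u by (cases i) (auto simp: attach_path_def path_edge_def)
  moreover have "path_edge k u i \<noteq> {}" for i by (auto simp: path_edge_def)
  moreover have "Inl ` e \<subseteq> verts (attach_path k G u p)" if "e \<in> edges G" for e
    using that G by (auto simp: hypergraph_def attach_path_def)
  moreover have "finite (verts (attach_path k G u p))" "Inl u \<in> verts (attach_path k G u p)"
    using G u by (simp_all add: hypergraph_def attach_path_def)
  moreover have "edges (attach_path k G u p) = (`) Inl ` edges G \<union> path_edge k u ` {..<p}"
    by (simp add: attach_path_def)
  moreover have "e \<noteq> {}" if "e \<in> edges G" for e using that G by (auto simp: hypergraph_def)
  ultimately show ?thesis unfolding hypergraph_def
    by (metis (no_types, lifting) Un_iff empty_iff image_iff image_is_empty lessThan_iff)
qed

lemma mem_path_edge: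
  "y \<in> path_edge k u i \<longleftrightarrow> y = path_vertex u i \<or> (\<exists>j<k - 1. y = Inr (i, j))"
  by (auto simp: path_edge_def)

lemma distance_from_attach_path_old:
  assumes k: "k \<ge> 2" and G: "hypergraph G" "hconnected G" and u: "u \<in> verts G" and x: "x \<in> verts G"
  shows "distance_from (attach_path k G u p) (Inl x)
    (case_sum (hdist G x) (\<lambda>(i, j). hdist G x u + i + 1))"
    (is "distance_from ?H _ ?f")
  unfolding distance_from_def
proof (intro conjI ballI impI)
  \<comment> \<open>One formula covers the root (\<open>i = 0\<close>) and all joints, so each path
    edge has its entry at one value and its new vertices one higher.\<close>
  have pv: "?f (path_vertex u i) = hdist G x u + i" for i by (cases i) auto
  show "Inl x \<in> verts ?H" using x by (simp add: attach_path_def)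
  show "?f (Inl x) = 0" using hdist_self[OF G x] by simp
  show "y = Inl x" if "y \<in> verts ?H" "?f y = 0" for y
    using that hdist_eq_0_iff[OF G x] by (auto simp: attach_path_def)
  show "?f y \<le> ?f z + 1" if e: "e \<in> edges ?H" "y \<in> e" "z \<in> e" for e y z
  proof -
    consider e' where "e' \<in> edges G" "e = Inl ` e'" | i where "e = path_edge k u i"
      using e by (auto simp: attach_path_def)
    then show ?thesis
    proof cases
      case 1 then show ?thesis using e hdist_edge_le[OF G x] by auto
    next
      case 2 then show ?thesis using e by (auto simp: mem_path_edge pv)
    qed
  qed
  show "\<exists>e\<in>edges ?H. \<exists>w\<in>verts ?H. y \<in> e \<and> w \<in> e \<and> ?f w < ?f y"
    if y: "y \<in> verts ?H" "?f y > 0" for y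
  proof (cases y)
    case (Inl z)
    then have "z \<in> verts G" "x \<noteq> z" using y hdist_self[OF G x] by (auto simp: attach_path_def)
    then obtain e w where "e \<in> edges G" "w \<in> verts G" "z \<in> e" "w \<in> e" "hdist G x w < hdist G x z"
      using hdist_descend[OF G x] by metis
    then show ?thesis using Inl
      by (intro bexI[of _ "Inl ` e"] bexI[of _ "Inl w"]) (auto simp: attach_path_def)
  next
    case (Inr c)
    then obtain i j where c: "y = Inr (i, j)" "i < p" "j < k - 1"
      using y by (cases c) (auto simp: attach_path_def)
    have "path_vertex u i \<in> verts ?H" using c u k by (cases i) (auto simp: attach_path_def)
    then show ?thesis using c
      by (intro bexI[of _ "path_edge k u i"] bexI[of _ "path_vertex u i"])
        (auto simp: pv mem_path_edge, auto simp: attach_path_def)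
  qed
qed

lemma distance_from_attach_path_new:
  assumes k: "k \<ge> 2" and G: "hypergraph G" "hconnected G" and u: "u \<in> verts G"
    and ij: "i < p" "j < k - 1"
  shows "distance_from (attach_path k G u p) (Inr (i, j))
    (case_sum (\<lambda>y. hdist G u y + i + 1) (path_dist (i, j)))"
    (is "distance_from ?H _ ?f")
  unfolding distance_from_def
proof (intro conjI ballI impI)
  \<comment> \<open>\<open>path_vertex u m\<close> is the entry of edge \<open>m\<close>. Towards
    the root, leaving edge \<open>i\<close> costs one step for every \<open>j\<close>; in the other
    direction the extra step disappears when \<open>j = 0\<close>, as the start is then the joint
    itself.\<close>
  have pv: "?f (path_vertex u m) = (if m \<le> i then i - m + 1 else m - Suc i + (if j = 0 then 0 else 1))" for m
    using hdist_self[OF G u] by (cases m) auto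
  show "Inr (i, j) \<in> verts ?H" using ij by (simp add: attach_path_def)
  show "?f (Inr (i, j)) = 0" by simp
  show "y = Inr (i, j)" if "y \<in> verts ?H" "?f y = 0" for y
    using that by (auto simp: attach_path_def split: if_splits)
  show "?f y \<le> ?f z + 1" if e: "e \<in> edges ?H" "y \<in> e" "z \<in> e" for e y z
  proof -
    consider e' where "e' \<in> edges G" "e = Inl ` e'" | m where "e = path_edge k u m"
      using e by (auto simp: attach_path_def)
    then show ?thesis
    proof cases
      case 1 then show ?thesis using e hdist_edge_le[OF G u] by auto
    next
      case 2 then show ?thesis using e by (auto simp: mem_path_edge pv)
    qed
  qed
  show "\<exists>e\<in>edges ?H. \<exists>w\<in>verts ?H. y \<in> e \<and> w \<in> e \<and> ?f w < ?f y"
    if y: "y \<in> verts ?H" "?f y > 0" for y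
  proof -
    have path: ?thesis if "y \<in> path_edge k u m" "w \<in> path_edge k u m" "w \<in> verts ?H" "m < p" "?f w < ?f y" for m w
      using that by (intro bexI[of _ "path_edge k u m"] bexI[of _ w]) (auto simp: attach_path_def)
    have pvV: "path_vertex u m \<in> verts ?H" if "m < p" for m
      using that u k by (cases m) (auto simp: attach_path_def)
    show ?thesis
    proof (cases y)
      case (Inl z)
      then have z: "z \<in> verts G" using y by (auto simp: attach_path_def)
      show ?thesis
      proof (cases "z = u")
        case True
        show ?thesis
        proof (cases "i = 0")
          case True
          then show ?thesis using Inl \<open>z = u\<close> ij k
            by (intro path[of 0 "Inr (0, j)"]) (auto simp: mem_path_edge attach_path_def)
        next
          case False
          then show ?thesis using Inl \<open>z = u\<close> ij k
            by (intro path[of 0 "Inr (0, 0)"]) (auto simp: mem_path_edge attach_path_def)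
        qed
      next
        case False
        then obtain e w where "e \<in> edges G" "w \<in> verts G" "z \<in> e" "w \<in> e" "hdist G u w < hdist G u z"
          using hdist_descend[OF G u z] by metis
        then show ?thesis using Inl
          by (intro bexI[of _ "Inl ` e"] bexI[of _ "Inl w"]) (auto simp: attach_path_def)
      qed
    next
      case (Inr c)
      then obtain i' j' where c: "y = Inr (i', j')" "i' < p" "j' < k - 1"
        using y by (cases c) (auto simp: attach_path_def)
      \<comment> \<open>Next vertex on the way from \<open>y\<close> to \<open>Inr (i, j)\<close>:
        from a later edge its entry; in the same edge the target; from an earlier edge its exit
        \<open>Inr (i', 0)\<close>, unless \<open>y\<close> is that exit. In that case the step lies
        in edge \<open>Suc i'\<close>, to the target if it is there and otherwise to the next
        joint.\<close>
      consider "i < i'" | "i' = i" | "i' < i" "j' \<noteq> 0" | "Suc i' = i" "j' = 0" | "Suc i' < i" "j' = 0"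
        by linarith
      then show ?thesis
      proof cases
        case 1
        then show ?thesis using c pvV
          by (intro path[of i' "path_vertex u i'"]) (auto simp: mem_path_edge pv)
      next
        case 2
        then show ?thesis using c y ij
          by (intro path[of i "Inr (i, j)"]) (auto simp: mem_path_edge attach_path_def split: if_splits)
      next
        case 3
        then show ?thesis using c k
          by (intro path[of i' "Inr (i', 0)"]) (auto simp: mem_path_edge attach_path_def)
      next
        case 4
        then show ?thesis using c ij
          by (intro path[of i "Inr (i, j)"]) (auto simp: mem_path_edge attach_path_def)
      next
        case 5
        then show ?thesis using c ij k
          by (intro path[of "Suc i'" "Inr (Suc i', 0)"]) (auto simp: mem_path_edge attach_path_def)
      qed
    qed
  qed
qed

lemma hconnected_attach_path:
  assumes "k \<ge> 2" "hypergraph G" "hconnected G" "u \<in> verts G"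
  shows "hconnected (attach_path k G u p)"
proof (rule hconnectedI)
  fix a assume "a \<in> verts (attach_path k G u p)"
  then consider x where "a = Inl x" "x \<in> verts G" | i j where "a = Inr (i, j)" "i < p" "j < k - 1"
    by (auto simp: attach_path_def)
  then show "\<exists>f. distance_from (attach_path k G u p) a f"
    by cases (use distance_from_attach_path_old[OF assms] distance_from_attach_path_new[OF assms] in blast)+
qed

lemma hdist_attach_path:
  assumes "k \<ge> 2" "hypergraph G" "hconnected G" "u \<in> verts G"
  shows "x \<in> verts G \<Longrightarrow> y \<in> verts G \<Longrightarrow> hdist (attach_path k G u p) (Inl x) (Inl y) = hdist G x y"
    and "x \<in> verts G \<Longrightarrow> i < p \<Longrightarrow> j < k - 1 \<Longrightarrow>
      hdist (attach_path k G u p) (Inl x) (Inr (i, j)) = hdist G x u + i + 1"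
    and "x \<in> verts G \<Longrightarrow> i < p \<Longrightarrow> j < k - 1 \<Longrightarrow>
      hdist (attach_path k G u p) (Inr (i, j)) (Inl x) = hdist G x u + i + 1"
    and "i < p \<Longrightarrow> j < k - 1 \<Longrightarrow> i' < p \<Longrightarrow> j' < k - 1 \<Longrightarrow>
      hdist (attach_path k G u p) (Inr (i, j)) (Inr (i', j')) = path_dist (i, j) (i', j')"
  using hdist_eqI[OF distance_from_attach_path_old[OF assms]]
    hdist_eqI[OF distance_from_attach_path_new[OF assms]]
  by (simp_all add: attach_path_def hdist_commute[of G u] del: path_dist.simps)

section \<open>Edges whose removal leaves one component per vertex\<close>

text \<open>The component of \<open>w\<close>, described by reachability instead of
  maximality.\<close>

definition reach_class :: "'a hypergraph \<Rightarrow> 'a \<Rightarrow> 'a hypergraph" where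
  "reach_class G w = \<lparr>verts = {y \<in> verts G. (w, y) \<in> (adjacency G)\<^sup>*},
     edges = {f \<in> edges G. f \<subseteq> {y \<in> verts G. (w, y) \<in> (adjacency G)\<^sup>*}}\<rparr>"

lemma reach_class_closed:
  assumes "hypergraph G" "f \<in> edges G" "y \<in> f" "y \<in> verts (reach_class G w)"
  shows "f \<subseteq> verts (reach_class G w)"
proof
  fix z assume z: "z \<in> f"
  then have "(y, z) \<in> adjacency G" using assms by (auto intro: adjacencyI)
  moreover have "(w, y) \<in> (adjacency G)\<^sup>*" using assms(4) by (simp add: reach_class_def)
  ultimately have "(w, z) \<in> (adjacency G)\<^sup>*" by simp
  moreover have "z \<in> verts G" using assms(1,2) z by (auto simp: hypergraph_def)
  ultimately show "z \<in> verts (reach_class G w)" by (simp add: reach_class_def)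
qed

lemma subhypergraph_reach_class:
  assumes "hypergraph G" "w \<in> verts G"
  shows "subhypergraph (reach_class G w) G"
  using assms by (auto simp: subhypergraph_def hypergraph_def reach_class_def)

text \<open>An edge meeting the class lies inside it, so a chain in \<open>G\<close> starting in the
  class is also a chain of the class.\<close>

lemma hconnected_reach_class:
  assumes G: "hypergraph G" and w: "w \<in> verts G"
  shows "hconnected (reach_class G w)"
proof (rule hconnectedI)
  fix a assume a: "a \<in> verts (reach_class G w)"
  let ?H = "reach_class G w"
  have H: "hypergraph ?H" using subhypergraph_reach_class[OF assms] by (simp add: subhypergraph_def)
  have reach: "(a, y) \<in> (adjacency ?H)\<^sup>* \<and> y \<in> verts ?H" if "(a, y) \<in> (adjacency G)\<^sup>*" for y
    using that
  proof induction
    case (step y z)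
    then obtain f where f: "f \<in> edges G" "y \<in> f" "z \<in> f" by (auto simp: adjacency_def)
    then have sub: "f \<subseteq> verts ?H" using step.IH by (intro reach_class_closed[OF G]) auto
    then have "f \<in> edges ?H" using f(1) by (simp add: reach_class_def)
    then have "(y, z) \<in> adjacency ?H" using f by (intro adjacencyI)
    then show ?case using step.IH sub f(3) by auto
  qed (use a in simp)
  have wa: "(w, a) \<in> (adjacency G)\<^sup>*" using a by (simp add: reach_class_def)
  then have aw: "(a, w) \<in> (adjacency G)\<^sup>*"
    using sym_rtrancl[OF sym_adjacency[of G]] by (auto dest: symD)
  have "(a, y) \<in> (adjacency ?H)\<^sup>*" if "y \<in> verts ?H" for y
  proof -
    have "(w, y) \<in> (adjacency G)\<^sup>*" using that by (simp add: reach_class_def)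
    then show ?thesis using reach aw by (meson rtrancl_trans)
  qed
  then show "\<exists>f. distance_from ?H a f" by (rule ex_distance_from[OF H a])
qed

text \<open>Connectedness puts \<open>C\<close> inside the class of any of its vertices; that class
  is connected, so maximality of \<open>C\<close> gives equality.\<close>

lemma component_eq_reach_class:
  assumes G: "hypergraph G" and C: "C \<in> components G" and y: "y \<in> verts C"
    and w: "w \<in> verts G" "(w, y) \<in> (adjacency G)\<^sup>*"
  shows "C = reach_class G w"
proof -
  have sub: "hypergraph C" "verts C \<subseteq> verts G" "edges C \<subseteq> edges G" and con: "hconnected C"
    and max: "\<And>H. subhypergraph H G \<Longrightarrow> hconnected H \<Longrightarrow> subhypergraph C H \<Longrightarrow> H = C"
    using C by (auto simp: components_def subhypergraph_def)
  have adj: "adjacency C \<subseteq> adjacency G" using sub(3) by (auto simp: adjacency_def)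
  have vC: "z \<in> verts (reach_class G w)" if z: "z \<in> verts C" for z
  proof -
    obtain vs es where "hpath C y vs es z" using con y z unfolding hconnected_def by blast
    then have "(y, z) \<in> (adjacency G)\<^sup>*"
      using hpath_imp_rtrancl_adjacency[of C] rtrancl_mono[OF adj] by auto
    then have "(w, z) \<in> (adjacency G)\<^sup>*" using w(2) by simp
    then show ?thesis using z sub(2) by (auto simp: reach_class_def)
  qed
  have eC: "f \<in> edges (reach_class G w)" if "f \<in> edges C" for f
  proof -
    have "f \<subseteq> verts (reach_class G w)" using that vC sub(1) by (auto simp: hypergraph_def)
    then show ?thesis using that sub(3) by (auto simp: reach_class_def)
  qed
  have "subhypergraph C (reach_class G w)" using vC eC sub(1) by (auto simp: subhypergraph_def)
  then show ?thesis
    using max[OF subhypergraph_reach_class[OF G w(1)] hconnected_reach_class[OF G w(1)]] by simp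
qed

text \<open>Up to the nearest vertex of \<open>e\<close>, shortest paths avoid \<open>e\<close>.\<close>

lemma reaches_nearest_vertex:
  assumes G: "hypergraph G" "hconnected G" and s: "s \<in> verts G"
    and m: "m \<in> verts G" "\<And>y. y \<in> e \<Longrightarrow> hdist G s m \<le> hdist G s y"
  shows "(s, m) \<in> (adjacency (delete_edge G e))\<^sup>*"
proof -
  \<comment> \<open>The claim is generalized from \<open>m\<close> to all vertices that are no
    farther from \<open>s\<close>, so that the induction on distance can descend.\<close>
  have "(s, y) \<in> (adjacency (delete_edge G e))\<^sup>*" if "y \<in> verts G" "hdist G s y \<le> hdist G s m" for y
    using that
  proof (induction "hdist G s y" arbitrary: y rule: less_induct)
    case less
    show ?case
    proof (cases "s = y")
      case False
      obtain f w where w: "f \<in> edges G" "w \<in> verts G" "y \<in> f" "w \<in> f" "hdist G s w < hdist G s y"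
        using hdist_descend[OF G s less(2) False] .
      \<comment> \<open>\<open>w\<close> is strictly closer to \<open>s\<close> than every vertex of
        \<open>e\<close>; hence the edge \<open>f\<close> containing it is not the deleted
        one.\<close>
      then have "w \<notin> e" using m(2)[of w] less(3) by linarith
      then have "(w, y) \<in> adjacency (delete_edge G e)"
        using w by (intro adjacencyI[of f]) (auto simp: delete_edge_def)
      moreover have "(s, w) \<in> (adjacency (delete_edge G e))\<^sup>*"
        using less(1)[of w] less(3) w by simp
      ultimately show ?thesis by simp
    qed simp
  qed
  then show ?thesis using m(1) by simp
qed

text \<open>Says that \<open>s\<close> hangs off \<open>e\<close> at \<open>r\<close>, in the purely
  metric form which the slide computation uses.\<close>

definition nearest_vertex :: "'a hypergraph \<Rightarrow> 'a set \<Rightarrow> 'a \<Rightarrow> 'a \<Rightarrow> bool" where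
  "nearest_vertex G e s r \<longleftrightarrow> r \<in> e \<and> (\<forall>y\<in>e - {r}. hdist G s y = hdist G s r + 1)"

text \<open>Every component of \<open>delete_edge G e\<close> is the class of some vertex of
  \<open>e\<close>. As there are as many components as vertices of \<open>e\<close>, these classes
  are distinct, so a vertex reaches only one vertex of \<open>e\<close> without using
  \<open>e\<close>.\<close>

lemma ex_nearest_vertex:
  assumes G: "hypergraph G" "hconnected G" and e: "e \<in> edges G"
    and card: "card (components (delete_edge G e)) = card e" and s: "s \<in> verts G"
  shows "\<exists>r. nearest_vertex G e s r"
proof -
  let ?G = "delete_edge G e"
  have G': "hypergraph ?G" using G by (auto simp: hypergraph_def delete_edge_def)
  have eV: "e \<subseteq> verts G" and fin: "finite e" and ne: "e \<noteq> {}"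
    using G e by (auto simp: hypergraph_def intro: finite_subset)
  have nearest: "\<exists>m\<in>e. \<forall>y\<in>e. hdist G a m \<le> hdist G a y" for a
    using arg_min_if_finite[OF fin ne, of "hdist G a"] by (meson linorder_not_less)
  have sym: "(b, a) \<in> (adjacency ?G)\<^sup>*" if "(a, b) \<in> (adjacency ?G)\<^sup>*" for a b
    using sym_rtrancl[OF sym_adjacency[of ?G]] that by (auto dest: symD)
  have "components ?G \<subseteq> reach_class ?G ` e"
  proof
    fix C assume C: "C \<in> components ?G"
    then have "hypergraph C" "verts C \<subseteq> verts G"
      by (auto simp: components_def subhypergraph_def delete_edge_def)
    then obtain y where y: "y \<in> verts C" "y \<in> verts G" by (auto simp: hypergraph_def)
    obtain m where m: "m \<in> e" "\<And>z. z \<in> e \<Longrightarrow> hdist G y m \<le> hdist G y z" using nearest by blast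
    then have mV: "m \<in> verts G" using eV by blast
    have "(m, y) \<in> (adjacency ?G)\<^sup>*" by (rule sym[OF reaches_nearest_vertex[OF G y(2) mV m(2)]])
    then have "C = reach_class ?G m"
      using mV by (intro component_eq_reach_class[OF G' C y(1)]) (auto simp: delete_edge_def)
    then show "C \<in> reach_class ?G ` e" using m(1) by blast
  qed
  then have "card e \<le> card (reach_class ?G ` e)" using fin card by (metis card_mono finite_imageI)
  \<comment> \<open>The image has at least \<open>card e\<close> elements, and never more, so no two
    vertices of \<open>e\<close> share a class.\<close>
  then have inj: "inj_on (reach_class ?G) e"
    using card_image_le[OF fin, of "reach_class ?G"] by (intro eq_card_imp_inj_on[OF fin]) simp
  have same: "w = w'" if "w \<in> e" "w' \<in> e" "(w, w') \<in> (adjacency ?G)\<^sup>*" for w w'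
  proof -
    have "(w, z) \<in> (adjacency ?G)\<^sup>* \<longleftrightarrow> (w', z) \<in> (adjacency ?G)\<^sup>*" for z
      using that(3) sym by (meson rtrancl_trans)
    then have "reach_class ?G w = reach_class ?G w'" by (simp add: reach_class_def)
    then show ?thesis using inj that by (auto dest: inj_onD)
  qed
  obtain r where r: "r \<in> e" "\<And>y. y \<in> e \<Longrightarrow> hdist G s r \<le> hdist G s y" using nearest by blast
  have sr: "(s, r) \<in> (adjacency ?G)\<^sup>*" using r eV by (intro reaches_nearest_vertex G s) auto
  have "hdist G s y = hdist G s r + 1" if y: "y \<in> e - {r}" for y
  proof -
    \<comment> \<open>A tie would make \<open>y\<close> nearest as well, joining \<open>r\<close>
      and \<open>y\<close> without \<open>e\<close>.\<close>
    have "hdist G s y \<noteq> hdist G s r"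
    proof
      assume "hdist G s y = hdist G s r"
      then have "(s, y) \<in> (adjacency ?G)\<^sup>*"
        using r y eV by (intro reaches_nearest_vertex G s) auto
      then have "(r, y) \<in> (adjacency ?G)\<^sup>*" using sym[OF sr] by simp
      then show False using same[of r y] r(1) y by auto
    qed
    moreover have "hdist G s y \<le> hdist G s r + 1"
      using y r(1) by (intro hdist_edge_le[OF G s e]) auto
    ultimately show ?thesis using r(2)[of y] y by simp
  qed
  then show ?thesis using r(1) by (auto simp: nearest_vertex_def)
qed

section \<open>Two pendant paths\<close>

abbreviation old :: "'a \<Rightarrow> ('a + nat \<times> nat) + nat \<times> nat" where
  "old x \<equiv> Inl (Inl x)"

abbreviation left :: "nat \<times> nat \<Rightarrow> ('a + nat \<times> nat) + nat \<times> nat" where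
  "left c \<equiv> Inl (Inr c)"

abbreviation right :: "nat \<times> nat \<Rightarrow> ('a + nat \<times> nat) + nat \<times> nat" where
  "right c \<equiv> Inr c"

text \<open>The table does not mention \<open>p\<close> and \<open>q\<close>, so it gives the
  distances both before and after an edge has moved between the paths.\<close>

fun two_paths_dist :: "'a hypergraph \<Rightarrow> 'a \<Rightarrow> 'a \<Rightarrow> ('a + nat \<times> nat) + nat \<times> nat \<Rightarrow>
    ('a + nat \<times> nat) + nat \<times> nat \<Rightarrow> nat" where
  "two_paths_dist G u v (Inl (Inl x)) (Inl (Inl y)) = hdist G x y"
| "two_paths_dist G u v (Inl (Inl x)) (Inl (Inr (i, j))) = hdist G x u + i + 1"
| "two_paths_dist G u v (Inl (Inl x)) (Inr (i, j)) = hdist G x v + i + 1"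
| "two_paths_dist G u v (Inl (Inr (i, j))) (Inl (Inl x)) = hdist G x u + i + 1"
| "two_paths_dist G u v (Inl (Inr c)) (Inl (Inr d)) = path_dist c d"
| "two_paths_dist G u v (Inl (Inr (i, j))) (Inr (i', j')) = hdist G u v + i + i' + 2"
| "two_paths_dist G u v (Inr (i, j)) (Inl (Inl x)) = hdist G x v + i + 1"
| "two_paths_dist G u v (Inr (i, j)) (Inl (Inr (i', j'))) = hdist G u v + i + i' + 2"
| "two_paths_dist G u v (Inr c) (Inr d) = path_dist c d"

lemma verts_attach_two_paths:
  "verts (attach_two_paths k G u v p q) =
    old ` verts G \<union> left ` ({..<p} \<times> {..<k - 1}) \<union> right ` ({..<q} \<times> {..<k - 1})"
  by (auto simp: attach_two_paths_def attach_path_def image_Un image_image)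

lemma attach_two_paths_cases:
  assumes "y \<in> verts (attach_two_paths k G u v p q)"
  obtains x where "x \<in> verts G" "y = old x" | i j where "i < p" "j < k - 1" "y = left (i, j)"
    | i j where "i < q" "j < k - 1" "y = right (i, j)"
  using assms unfolding verts_attach_two_paths by auto

locale two_pendant_paths =
  fixes k :: nat and G :: "'a hypergraph" and u v :: 'a
  assumes k: "k \<ge> 2" and G: "hypergraph G" "hconnected G"
    and u: "u \<in> verts G" and v: "v \<in> verts G"
begin

lemma Inl_in_attach_path: "Inl v \<in> verts (attach_path k G u p)"
  using v by (simp add: attach_path_def)

lemma hypergraph_attach_two_paths: "hypergraph (attach_two_paths k G u v p q)"
  unfolding attach_two_paths_def
  by (intro hypergraph_attach_path k G u Inl_in_attach_path)

lemma hconnected_attach_two_paths: "hconnected (attach_two_paths k G u v p q)"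
  unfolding attach_two_paths_def
  by (intro hypergraph_attach_path hconnected_attach_path k G u Inl_in_attach_path)

lemma hdist_attach_two_paths:
  assumes y: "y \<in> verts (attach_two_paths k G u v p q)" and z: "z \<in> verts (attach_two_paths k G u v p q)"
  shows "hdist (attach_two_paths k G u v p q) y z = two_paths_dist G u v y z"
proof -
  let ?A = "attach_path k G u p"
  note A = hdist_attach_path[OF k G u]
  note B = hdist_attach_path[OF k hypergraph_attach_path[OF k G(1) u]
      hconnected_attach_path[OF k G u] Inl_in_attach_path]
  have V: "Inl x \<in> verts ?A \<longleftrightarrow> x \<in> verts G" "Inr (i, j) \<in> verts ?A \<longleftrightarrow> i < p \<and> j < k - 1" for x i j
    by (auto simp: attach_path_def)
  show ?thesis unfolding attach_two_paths_def
    by (rule attach_two_paths_cases[OF y]; rule attach_two_paths_cases[OF z])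
      (simp_all add: A B V u v hdist_commute[of G v u] del: path_dist.simps One_nat_def)
qed

end

lemma two_paths_dist_commute: "two_paths_dist G u v y z = two_paths_dist G u v z y"
  by (cases "(G, u, v, y, z)" rule: two_paths_dist.cases) (auto simp: hdist_commute)

text \<open>Mirrors the construction, which reduces the move towards the \<open>u\<close>-path to
  the move towards the \<open>v\<close>-path.\<close>

fun swap_paths :: "('a + nat \<times> nat) + nat \<times> nat \<Rightarrow> ('a + nat \<times> nat) + nat \<times> nat" where
  "swap_paths (Inl (Inl x)) = old x"
| "swap_paths (Inl (Inr c)) = right c"
| "swap_paths (Inr c) = left c"

lemma swap_paths_swap_paths [simp]: "swap_paths (swap_paths y) = y"
  by (cases y rule: swap_paths.cases) auto

lemma bij_betw_swap_paths:
  "bij_betw swap_paths (verts (attach_two_paths k G u v p q)) (verts (attach_two_paths k G v u q p))"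
  by (rule bij_betw_byWitness[where f' = swap_paths]) (auto simp: verts_attach_two_paths)

lemma two_paths_dist_swap_paths:
  "two_paths_dist G v u (swap_paths y) (swap_paths z) = two_paths_dist G u v y z"
  by (cases "(G, u, v, y, z)" rule: two_paths_dist.cases) (auto simp: hdist_commute)

text \<open>Moving the last edge of the \<open>u\<close>-path to the \<open>v\<close>-path amounts to sliding the parts of \<open>G\<close> that
  hang off \<open>e\<close> by one edge along the path which consists of the \<open>u\<close>-path, \<open>e\<close> and the \<open>v\<close>-path. The
  following bijection describes it the other way round: the vertices of that path slide towards the
  end of the \<open>v\<close>-path and all other vertices stay.\<close>

fun slide :: "(nat \<Rightarrow> 'a) \<Rightarrow> ('a \<Rightarrow> nat) \<Rightarrow> 'a set \<Rightarrow> 'a \<Rightarrow> 'a \<Rightarrow>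
    ('a + nat \<times> nat) + nat \<times> nat \<Rightarrow> ('a + nat \<times> nat) + nat \<times> nat" where
  "slide \<sigma> \<tau> e u v (Inl (Inl x)) =
     (if x = u then old v else if x = v then right (0, 0) else if x \<in> e then right (0, \<tau> x) else old x)"
| "slide \<sigma> \<tau> e u v (Inl (Inr (i, j))) =
     (if i = 0 then (if j = 0 then old u else old (\<sigma> j)) else left (i - 1, j))"
| "slide \<sigma> \<tau> e u v (Inr (i, j)) = right (i + 1, j)"

fun slide_back :: "(nat \<Rightarrow> 'a) \<Rightarrow> ('a \<Rightarrow> nat) \<Rightarrow> 'a set \<Rightarrow> 'a \<Rightarrow> 'a \<Rightarrow>
    ('a + nat \<times> nat) + nat \<times> nat \<Rightarrow> ('a + nat \<times> nat) + nat \<times> nat" where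
  "slide_back \<sigma> \<tau> e u v (Inl (Inl x)) =
     (if x = u then left (0, 0) else if x = v then old u else if x \<in> e then left (0, \<tau> x) else old x)"
| "slide_back \<sigma> \<tau> e u v (Inl (Inr (i, j))) = left (i + 1, j)"
| "slide_back \<sigma> \<tau> e u v (Inr (i, j)) =
     (if i = 0 then (if j = 0 then old v else old (\<sigma> j)) else right (i - 1, j))"

text \<open>\<open>\<sigma>\<close> and \<open>\<tau>\<close> are mutually inverse labellings of the
  vertices of \<open>e\<close> other than \<open>u\<close> and \<open>v\<close> by 1, ..., k - 2.
  Label 0 is left out because in a path edge it marks the joint; with this labelling
  \<open>e\<close> looks like one more edge of the long path.\<close>

locale hyperedge_slide =
  fixes k :: nat and G :: "'a hypergraph" and e :: "'a set" and u v :: 'a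
    and \<sigma> :: "nat \<Rightarrow> 'a" and \<tau> :: "'a \<Rightarrow> nat"
  assumes k: "k \<ge> 2" and G: "hypergraph G" "hconnected G" and e: "e \<in> edges G"
    and ue: "u \<in> e" and ve: "v \<in> e" and uv: "u \<noteq> v"
    and \<sigma>: "\<And>j. 0 < j \<Longrightarrow> j < k - 1 \<Longrightarrow> \<sigma> j \<in> e \<and> \<sigma> j \<noteq> u \<and> \<sigma> j \<noteq> v \<and> \<tau> (\<sigma> j) = j"
    and \<tau>: "\<And>x. x \<in> e \<Longrightarrow> x \<noteq> u \<Longrightarrow> x \<noteq> v \<Longrightarrow> 0 < \<tau> x \<and> \<tau> x < k - 1 \<and> \<sigma> (\<tau> x) = x"
begin

lemma e_verts: "x \<in> e \<Longrightarrow> x \<in> verts G"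
  using G(1) e by (auto simp: hypergraph_def)

sublocale paths: two_pendant_paths k G u v
  by unfold_locales (use k G e_verts ue ve in auto)

lemma sigma_simps:
  assumes "0 < j" "j < k - Suc 0"
  shows "\<sigma> j \<in> e" "\<sigma> j \<in> verts G" "\<sigma> j \<noteq> u" "\<sigma> j \<noteq> v" "u \<noteq> \<sigma> j" "v \<noteq> \<sigma> j" "\<tau> (\<sigma> j) = j"
  using \<sigma>[of j] assms e_verts[of "\<sigma> j"] by auto

lemma tau_simps:
  assumes "x \<in> e" "x \<noteq> u" "x \<noteq> v"
  shows "\<tau> x \<noteq> 0" "\<tau> x < k - Suc 0" "\<sigma> (\<tau> x) = x"
  using \<tau>[OF assms] by auto

lemma bij_betw_slide:
  assumes "p \<ge> 1"
  shows "bij_betw (slide \<sigma> \<tau> e u v) (verts (attach_two_paths k G u v p q))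
    (verts (attach_two_paths k G u v (p - 1) (q + 1)))"
proof (rule bij_betw_byWitness[where f' = "slide_back \<sigma> \<tau> e u v"])
  let ?H = "attach_two_paths k G u v p q" and ?H' = "attach_two_paths k G u v (p - 1) (q + 1)"
  have eV: "u \<in> verts G" "v \<in> verts G" using e_verts ue ve by auto
  note simps = verts_attach_two_paths eV ue ve uv uv[symmetric]
  show "\<forall>y\<in>verts ?H. slide_back \<sigma> \<tau> e u v (slide \<sigma> \<tau> e u v y) = y"
    using k by (auto elim!: attach_two_paths_cases simp: simps sigma_simps tau_simps)
  show "\<forall>y\<in>verts ?H'. slide \<sigma> \<tau> e u v (slide_back \<sigma> \<tau> e u v y) = y"
    using k by (auto elim!: attach_two_paths_cases simp: simps sigma_simps tau_simps)
  show "slide \<sigma> \<tau> e u v ` verts ?H \<subseteq> verts ?H'"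
    using k assms by (auto simp: simps sigma_simps tau_simps split: if_splits)
  show "slide_back \<sigma> \<tau> e u v ` verts ?H' \<subseteq> verts ?H"
    using k assms by (auto simp: simps sigma_simps tau_simps split: if_splits)
qed

lemma slide_isometric_outside:
  assumes "s \<in> verts G - e" "t \<in> verts G - e"
  shows "two_paths_dist G u v (slide \<sigma> \<tau> e u v (old s)) (slide \<sigma> \<tau> e u v (old t))
    = two_paths_dist G u v (old s) (old t)"
  using assms ue ve by auto

definition on_path where
  "on_path y \<longleftrightarrow> (\<exists>x\<in>e. y = old x) \<or> (\<exists>i j. j < k - 1 \<and> (y = left (i, j) \<or> y = right (i, j)))"

lemma on_path_cases:
  assumes "on_path y"
  obtains "y = old u" | "y = old v" | w where "w \<in> e" "w \<noteq> u" "w \<noteq> v" "y = old w"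
    | "y = left (0, 0)" | j where "0 < j" "j < k - Suc 0" "y = left (0, j)"
    | i j where "y = left (Suc i, j)" | i j where "y = right (i, j)"
proof -
  from assms consider x where "x \<in> e" "y = old x" | i j where "j < k - 1" "y = left (i, j)"
    | i j where "y = right (i, j)"
    unfolding on_path_def by blast
  then show thesis
  proof cases
    case (2 i j)
    then show thesis using that by (cases i; cases j) auto
  qed (use that in blast)+
qed

text \<open>All edges of the long path, \<open>e\<close> included, have two joints and k - 2 equally
  labelled further vertices, so moving everything by one edge preserves the metric. The case rule
  follows the clauses of \<open>slide\<close>.\<close>

lemma slide_isometric_path:
  assumes y: "on_path y" and z: "on_path z"
  shows "two_paths_dist G u v (slide \<sigma> \<tau> e u v y) (slide \<sigma> \<tau> e u v z) = two_paths_dist G u v y z"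
proof -
  have d: "hdist G x y = (if x = y then 0 else 1)" if "x \<in> e" "y \<in> e" for x y
    by (rule hdist_edge[OF G e that])
  have \<sigma>_inj: "\<sigma> i = \<sigma> j \<longleftrightarrow> i = j" if "0 < i" "i < k - Suc 0" "0 < j" "j < k - Suc 0" for i j
    using that sigma_simps(7) by metis
  have \<tau>_inj: "\<tau> x = \<tau> y \<longleftrightarrow> x = y" if "x \<in> e" "x \<noteq> u" "x \<noteq> v" "y \<in> e" "y \<noteq> u" "y \<noteq> v" for x y
    using that tau_simps(3) by metis
  show ?thesis
    by (rule on_path_cases[OF y]; rule on_path_cases[OF z]; hypsubst)
      (simp_all add: d ue ve uv uv[symmetric] sigma_simps tau_simps \<sigma>_inj \<tau>_inj)
qed

end

section \<open>The change of the quadratic form\<close>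

definition left_weight where
  "left_weight k p u x = (x (old u) + (\<Sum>c\<in>{..<p} \<times> {..<k - 1}. x (left c)) :: real)"

definition right_weight where
  "right_weight k q v x = (x (old v) + (\<Sum>c\<in>{..<q} \<times> {..<k - 1}. x (right c)) :: real)"

context hyperedge_slide
begin

definition slide_change where
  "slide_change y z = real (two_paths_dist G u v (slide \<sigma> \<tau> e u v y) (slide \<sigma> \<tau> e u v z))
     - real (two_paths_dist G u v y z)"

lemma slide_change_commute: "slide_change y z = slide_change z y"
  by (simp add: slide_change_def two_paths_dist_commute[of G u v])

lemma slide_change_right:
  assumes "s \<in> verts G - e"
  shows "slide_change (old s) (right c) = 1"
  using assms ue ve by (cases c) (auto simp: slide_change_def)

text \<open>The distance to \<open>u\<close> plus the depth drops by one per edge moved. Only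
  \<open>left (0, j)\<close> with \<open>j > 0\<close>, which lands in \<open>e\<close>, behaves
  differently: if its image is \<open>r\<close> and \<open>r\<close> is neither \<open>u\<close> nor
  \<open>v\<close>, the distance drops by 2, from two above to exactly that of
  \<open>r\<close>.\<close>

lemma slide_change_left:
  assumes s: "s \<in> verts G - e" and r: "nearest_vertex G e s r" and c: "snd c < k - 1"
  shows "slide_change (old s) (left c) \<ge> - 1 - (if r \<noteq> u \<and> r \<noteq> v \<and> c = (0, \<tau> r) then 1 else 0)"
proof -
  obtain i j where ij: "c = (i, j)" by (cases c)
  have su: "s \<noteq> u" "s \<noteq> v" "s \<notin> e" using s ue ve by auto
  have d: "hdist G s y = hdist G s r + (if y = r then 0 else 1)" if "y \<in> e" for y
    using r that by (auto simp: nearest_vertex_def)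
  show ?thesis
  proof (cases "i = 0 \<and> j \<noteq> 0")
    case True
    then have j: "\<sigma> j \<in> e" "\<sigma> j \<noteq> u" "\<sigma> j \<noteq> v" "\<tau> (\<sigma> j) = j" using \<sigma> c ij by auto
    then show ?thesis using True su ij d[OF j(1)] d[OF ue] uv
      by (auto simp: slide_change_def)
  next
    case False
    then show ?thesis using su ij by (auto simp: slide_change_def)
  qed
qed

text \<open>\<open>v\<close> moves one step beyond itself, \<open>u\<close> moves to
  \<open>v\<close>, and every other \<open>w\<close> moves into the first edge of the
  \<open>v\<close>-path, which costs 2 if \<open>w = r\<close> and is never a decrease. The bound is
  split into one summand per distinguished vertex so that the sum over \<open>e\<close>
  collapses.\<close>

lemma slide_change_edge:
  assumes s: "s \<in> verts G - e" and r: "nearest_vertex G e s r" and w: "w \<in> e"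
  shows "slide_change (old s) (old w) \<ge> (if w = v then 1 else 0)
    + (if w = u then (if r = u then 1 else if r = v then - 1 else 0) else 0)
    + (if w = r then (if r \<noteq> u \<and> r \<noteq> v then 2 else 0) else 0)"
proof -
  have su: "s \<noteq> u" "s \<noteq> v" "s \<notin> e" using s ue ve by auto
  have d: "hdist G s y = hdist G s r + (if y = r then 0 else 1)" if "y \<in> e" for y
    using r that by (auto simp: nearest_vertex_def)
  consider "w = u" | "w = v" | "w \<noteq> u" "w \<noteq> v" by blast
  then show ?thesis
  proof cases
    case 1
    then show ?thesis using su uv d[OF ue] d[OF ve] by (simp add: slide_change_def)
  next
    case 2
    then show ?thesis using su uv by (simp add: slide_change_def)
  next
    case 3
    then show ?thesis using su w d[OF w] d[OF ve] by (simp add: slide_change_def)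
  qed
qed

context
  fixes p q :: nat and x :: "('a + nat \<times> nat) + nat \<times> nat \<Rightarrow> real" and l :: real
  assumes p: "p \<ge> 1"
    and x: "\<And>y. y \<in> verts (attach_two_paths k G u v p q) \<Longrightarrow> x y > 0"
    and eig: "\<And>y. y \<in> verts (attach_two_paths k G u v p q) \<Longrightarrow>
      (\<Sum>t\<in>verts (attach_two_paths k G u v p q). real (hdist (attach_two_paths k G u v p q) y t) * x t)
        = l * x y"
begin

definition path_part where
  "path_part = old ` e \<union> left ` ({..<p} \<times> {..<k - 1}) \<union> right ` ({..<q} \<times> {..<k - 1})"

lemma finite_e: "finite e"
  using G(1) e by (auto simp: hypergraph_def intro: finite_subset)

lemma sum_path_part:
  "(\<Sum>t\<in>path_part. f t) = (\<Sum>w\<in>e. f (old w)) + (\<Sum>c\<in>{..<p} \<times> {..<k - 1}. f (left c))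
     + (\<Sum>c\<in>{..<q} \<times> {..<k - 1}. f (right c))" for f :: "_ \<Rightarrow> real"
proof -
  have "sum f (left ` ({..<p} \<times> {..<k - 1})) = (\<Sum>c\<in>{..<p} \<times> {..<k - 1}. f (left c))"
    "sum f (right ` ({..<q} \<times> {..<k - 1})) = (\<Sum>c\<in>{..<q} \<times> {..<k - 1}. f (right c))"
    "sum f (old ` e) = (\<Sum>w\<in>e. f (old w))"
    by (subst sum.reindex; simp add: inj_on_def)+
  moreover have "sum f path_part = sum f (old ` e) + sum f (left ` ({..<p} \<times> {..<k - 1}))
      + sum f (right ` ({..<q} \<times> {..<k - 1}))"
    unfolding path_part_def using finite_e
    by (subst sum.union_disjoint; (subst sum.union_disjoint)?; auto)
  ultimately show ?thesis by simp
qed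

text \<open>\<open>Perron_vector_less\<close> for the first edge of the \<open>u\<close>-path and
  \<open>e\<close>, which share \<open>u\<close>. It pays for the vertex that loses 2.\<close>

lemma old_weight_bound:
  assumes r: "r \<in> e" "r \<noteq> u" "r \<noteq> v"
  shows "x (left (0, \<tau> r)) < x (old u) + 2 * x (old r)"
proof (rule Perron_vector_less[where G = "attach_two_paths k G u v p q"])
  let ?H = "attach_two_paths k G u v p q"
  show "hypergraph ?H" "hconnected ?H"
    by (rule paths.hypergraph_attach_two_paths paths.hconnected_attach_two_paths)+
  show "Inl ` path_edge k u 0 \<in> edges ?H" "Inl ` (Inl ` e) \<in> edges ?H"
    using p e by (auto simp: attach_two_paths_def attach_path_def)
  show "left (0, \<tau> r) \<in> Inl ` path_edge k u 0"
    using \<tau>[OF r] by (auto simp: path_edge_def)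
  show "old u \<in> Inl ` path_edge k u 0" by (auto simp: path_edge_def)
qed (use x eig ue r in auto)

text \<open>Adds up the three kinds of path vertices. The surplus over \<open>R - L\<close> (right
  minus left weight) is zero only for \<open>r = v\<close>; otherwise it is positive, by
  \<open>old_weight_bound\<close> when also \<open>r \<noteq> u\<close>.\<close>

lemma slide_gain:
  assumes s: "s \<in> verts G - e" and r: "nearest_vertex G e s r"
  shows "(\<Sum>t\<in>path_part. slide_change (old s) t * x t)
    \<ge> right_weight k q v x - left_weight k p u x + (if r = v then 0 else if r = u then 2 * x (old u)
      else x (old u) + 2 * x (old r) - x (left (0, \<tau> r)))"
proof -
  let ?P = "{..<p} \<times> {..<k - 1}" and ?Q = "{..<q} \<times> {..<k - 1}"
  \<comment> \<open>\<open>m\<close> is the coefficient of \<open>u\<close>; \<open>h\<close>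
    indicates that \<open>r\<close> is neither \<open>u\<close> nor \<open>v\<close>.\<close>
  define m where "m = (if r = u then 1 else if r = v then - 1 else 0 :: real)"
  define h where "h = (if r \<noteq> u \<and> r \<noteq> v then 1 else 0 :: real)"
  have re: "r \<in> e" using r by (simp add: nearest_vertex_def)
  have V: "old w \<in> verts (attach_two_paths k G u v p q)" if "w \<in> e" for w
    using that G(1) e by (auto simp: verts_attach_two_paths hypergraph_def)
  have "(\<Sum>c\<in>?Q. slide_change (old s) (right c) * x (right c)) = (\<Sum>c\<in>?Q. x (right c))"
    by (simp add: slide_change_right[OF s])
  moreover have "(\<Sum>c\<in>?P. slide_change (old s) (left c) * x (left c))
      \<ge> - (\<Sum>c\<in>?P. x (left c)) - h * x (left (0, \<tau> r))"
  proof -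
    have "(\<Sum>c\<in>?P. (- 1 - (if r \<noteq> u \<and> r \<noteq> v \<and> c = (0, \<tau> r) then 1 else 0)) * x (left c))
        \<le> (\<Sum>c\<in>?P. slide_change (old s) (left c) * x (left c))"
      by (intro sum_mono mult_right_mono slide_change_left[OF s r])
        (auto intro!: less_imp_le x simp: verts_attach_two_paths)
    moreover have "(\<Sum>c\<in>?P. (- 1 - (if r \<noteq> u \<and> r \<noteq> v \<and> c = (0, \<tau> r) then 1 else 0)) * x (left c))
        = (\<Sum>c\<in>?P. - x (left c) - (if c = (0, \<tau> r) then h * x (left c) else 0))"
      by (rule sum.cong) (auto simp: h_def)
    moreover have "\<dots> = - (\<Sum>c\<in>?P. x (left c)) - h * x (left (0, \<tau> r))"
    proof (cases "r \<noteq> u \<and> r \<noteq> v")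
      case True
      \<comment> \<open>Because \<open>p\<close> is positive, the exceptional vertex does occur in
        the sum.\<close>
      then have "(0, \<tau> r) \<in> ?P" using p \<tau>[OF re] by auto
      then show ?thesis by (simp add: sum_subtractf sum_negf)
    next
      case False
      then have "h = 0" by (simp add: h_def)
      then show ?thesis by (simp add: sum_subtractf sum_negf cong: if_cong)
    qed
    ultimately show ?thesis by simp
  qed
  moreover have "(\<Sum>w\<in>e. slide_change (old s) (old w) * x (old w)) \<ge> x (old v) + m * x (old u) + 2 * h * x (old r)"
  proof -
    have "(\<Sum>w\<in>e. ((if w = v then 1 else 0)
    + (if w = u then (if r = u then 1 else if r = v then - 1 else 0) else 0)
    + (if w = r then (if r \<noteq> u \<and> r \<noteq> v then 2 else 0) else 0)) * x (old w))
        \<le> (\<Sum>w\<in>e. slide_change (old s) (old w) * x (old w))"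
      by (intro sum_mono mult_right_mono slide_change_edge[OF s r]) (auto intro!: less_imp_le x V)
    moreover have "(\<Sum>w\<in>e. ((if w = v then 1 else 0)
    + (if w = u then (if r = u then 1 else if r = v then - 1 else 0) else 0)
    + (if w = r then (if r \<noteq> u \<and> r \<noteq> v then 2 else 0) else 0)) * x (old w))
      = (\<Sum>w\<in>e. (if w = v then x (old w) else 0) + (if w = u then m * x (old w) else 0)
          + (if w = r then 2 * h * x (old w) else 0))"
      by (rule sum.cong) (auto simp: h_def m_def algebra_simps)
    moreover have "\<dots> = x (old v) + m * x (old u) + 2 * h * x (old r)"
      using finite_e ue ve re by (simp add: sum.distrib)
    ultimately show ?thesis by simp
  qed
  ultimately have "(\<Sum>t\<in>path_part. slide_change (old s) t * x t) \<ge> x (old v) + m * x (old u) + 2 * h * x (old r)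
     - (\<Sum>c\<in>?P. x (left c)) - h * x (left (0, \<tau> r)) + (\<Sum>c\<in>?Q. x (right c))"
    unfolding sum_path_part by simp
  then show ?thesis using uv by (auto simp: left_weight_def right_weight_def m_def h_def split: if_splits)
qed

text \<open>Every hanging vertex contributes a nonnegative amount, since its gain is at least right
  minus left weight. The vertex \<open>a\<close> makes the total positive: either the weights differ
  strictly, or \<open>a\<close> hangs at some \<open>b \<noteq> v\<close> and has a surplus.\<close>

lemma slide_increases:
  assumes near: "\<And>s. s \<in> verts G \<Longrightarrow> \<exists>r. nearest_vertex G e s r"
    and le: "left_weight k p u x \<le> right_weight k q v x"
    and a: "a \<in> verts G - e" "nearest_vertex G e a b" "left_weight k p u x < right_weight k q v x \<or> b \<noteq> v"
  shows "l < distance_spectral_radius (attach_two_paths k G u v (p - 1) (q + 1))"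
proof (rule distance_spectral_radius_lessI)
  let ?H = "attach_two_paths k G u v p q" and ?H' = "attach_two_paths k G u v (p - 1) (q + 1)"
  let ?\<phi> = "slide \<sigma> \<tau> e u v" and ?S = "old ` (verts G - e)"
  show H: "hypergraph ?H" "hypergraph ?H'" "hconnected ?H'"
    by (rule paths.hypergraph_attach_two_paths paths.hconnected_attach_two_paths)+
  show bij: "bij_betw ?\<phi> (verts ?H) (verts ?H')"
    by (rule bij_betw_slide[OF p])
  have V: "verts ?H = ?S \<union> path_part"
    using G(1) e by (auto simp: verts_attach_two_paths path_part_def hypergraph_def)
  have "old u \<in> verts ?H" using paths.u by (simp add: verts_attach_two_paths)
  then show "\<exists>y\<in>verts ?H. x y \<noteq> 0" using x by (metis less_irrefl)
  show "(\<Sum>t\<in>verts ?H. real (hdist ?H y t) * x t) = l * x y" if "y \<in> verts ?H" for y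
    by (rule eig[OF that])
  define F where "F y z = slide_change y z * x y * x z" for y z
  have fin: "finite ?S" "finite path_part"
    using G(1) finite_e by (auto simp: path_part_def hypergraph_def)
  have pos: "x y > 0" if "y \<in> ?S \<union> path_part" for y using x that V by simp
  have on: "on_path y" if "y \<in> path_part" for y
    using that unfolding on_path_def path_part_def by auto
  have "(\<Sum>y\<in>verts ?H. \<Sum>z\<in>verts ?H. (real (hdist ?H' (?\<phi> y) (?\<phi> z)) - real (hdist ?H y z)) * x y * x z)
      = (\<Sum>y\<in>verts ?H. \<Sum>z\<in>verts ?H. F y z)"
    using bij_betwE[OF bij] by (intro sum.cong refl)
      (simp add: F_def slide_change_def paths.hdist_attach_two_paths)
  also have "\<dots> = 2 * (\<Sum>y\<in>?S. \<Sum>z\<in>path_part. F y z)"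
    unfolding V
  proof (rule sum_two_blocks[OF fin])
    show "?S \<inter> path_part = {}" by (auto simp: path_part_def)
    show "F y z = F z y" for y z by (simp add: F_def slide_change_commute[of y])
    show "F y z = 0" if "y \<in> ?S" "z \<in> ?S" for y z
      using that slide_isometric_outside
      by (auto simp: F_def slide_change_def simp del: slide.simps)
    show "F y z = 0" if "y \<in> path_part" "z \<in> path_part" for y z
      using slide_isometric_path[OF on[OF that(1)] on[OF that(2)]]
      by (simp add: F_def slide_change_def)
  qed
  also have "(\<Sum>y\<in>?S. \<Sum>z\<in>path_part. F y z)
      = (\<Sum>s\<in>verts G - e. x (old s) * (\<Sum>t\<in>path_part. slide_change (old s) t * x t))"
    by (subst sum.reindex) (auto simp: inj_on_def F_def sum_distrib_left mult_ac)
  finally have eq: "(\<Sum>y\<in>verts ?H. \<Sum>z\<in>verts ?H.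
      (real (hdist ?H' (?\<phi> y) (?\<phi> z)) - real (hdist ?H y z)) * x y * x z)
    = 2 * (\<Sum>s\<in>verts G - e. x (old s) * (\<Sum>t\<in>path_part. slide_change (old s) t * x t))" .
  have xe: "x (old w) > 0" if "w \<in> e" for w using pos that by (auto simp: path_part_def)
  have gain: "(\<Sum>t\<in>path_part. slide_change (old s) t * x t) \<ge> right_weight k q v x - left_weight k p u x \<and>
      (r \<noteq> v \<longrightarrow> (\<Sum>t\<in>path_part. slide_change (old s) t * x t) > right_weight k q v x - left_weight k p u x)"
    if "s \<in> verts G - e" "nearest_vertex G e s r" for s r
    using slide_gain[OF that] old_weight_bound[of r] xe[OF ue] that(2)
    by (auto simp: nearest_vertex_def split: if_splits)
  have "(\<Sum>s\<in>verts G - e. x (old s) * (\<Sum>t\<in>path_part. slide_change (old s) t * x t)) > 0"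
  proof (rule sum_pos2)
    show "finite (verts G - e)" using G(1) by (auto simp: hypergraph_def)
    show "a \<in> verts G - e" by (rule a(1))
    show "0 < x (old a) * (\<Sum>t\<in>path_part. slide_change (old a) t * x t)"
      using gain[OF a(1,2)] a(3) le pos[of "old a"] a(1) by (intro mult_pos_pos) auto
    show "0 \<le> x (old s) * (\<Sum>t\<in>path_part. slide_change (old s) t * x t)"
      if s: "s \<in> verts G - e" for s
    proof -
      obtain r where "nearest_vertex G e s r" using near s by blast
      then show ?thesis using gain[OF s] le pos[of "old s"] s by (intro mult_nonneg_nonneg) fastforce+
    qed
  qed
  then show "0 < (\<Sum>y\<in>verts ?H. \<Sum>z\<in>verts ?H.
      (real (hdist ?H' (?\<phi> y) (?\<phi> z)) - real (hdist ?H y z)) * x y * x z)"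
    unfolding eq by simp
qed

end

end

section \<open>Labelling the edge and choosing the direction of the move\<close>

lemma ex_hyperedge_slide:
  assumes "k \<ge> 2" "hypergraph G" "hconnected G" "e \<in> edges G" "card e = k" "u \<in> e" "v \<in> e" "u \<noteq> v"
  obtains \<sigma> \<tau> where "hyperedge_slide k G e u v \<sigma> \<tau>"
proof -
  have "finite e" using assms(1,5) by (metis card.infinite not_numeral_le_zero)
  moreover have "card (e - {u, v}) = card {1..<k - 1}" using assms by (simp add: card_Diff_subset)
  ultimately obtain \<sigma> where \<sigma>: "bij_betw \<sigma> {1..<k - 1} (e - {u, v})"
    using finite_same_card_bij[of "{1..<k - 1}" "e - {u, v}"] by auto
  have "hyperedge_slide k G e u v \<sigma> (the_inv_into {1..<k - 1} \<sigma>)"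
  proof (unfold_locales, goal_cases)
    case (8 j)
    then have "j \<in> {1..<k - 1}" by simp
    then show ?case using \<sigma> bij_betwE[OF \<sigma>] by (auto simp: bij_betw_def the_inv_into_f_f)
  next
    case (9 y)
    then have "y \<in> e - {u, v}" by simp
    then show ?case using bij_betwE[OF bij_betw_the_inv_into[OF \<sigma>]] \<sigma>
      by (auto simp: bij_betw_def f_the_inv_into_f Suc_le_eq)
  qed (use assms in auto)
  then show thesis by (rule that)
qed

theorem theorem3p2:
  fixes G :: "'a hypergraph" and e :: "'a set" and u v :: 'a and k p q :: nat
  assumes "k \<ge> 2"
    and "hypergraph G" and "uniform k G" and "hconnected G"
    and "card (edges G) \<ge> 2"
    and "e \<in> edges G" and "u \<in> e" and "v \<in> e" and "u \<noteq> v"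
    and "card (components (delete_edge G e)) = k"
    and "p \<ge> 1" and "q \<ge> 1"
  shows "distance_spectral_radius (attach_two_paths k G u v p q)
           < distance_spectral_radius (attach_two_paths k G u v (p - 1) (q + 1))
       \<or> distance_spectral_radius (attach_two_paths k G u v p q)
           < distance_spectral_radius (attach_two_paths k G u v (p + 1) (q - 1))"
proof -
  let ?H = "attach_two_paths k G u v p q" and ?K = "attach_two_paths k G v u q p"
  let ?l = "distance_spectral_radius ?H"
  have e: "card e = k" using assms by (simp add: uniform_def)
  obtain \<sigma> \<tau> where "hyperedge_slide k G e u v \<sigma> \<tau>"
    using ex_hyperedge_slide assms e by metis
  then interpret uv: hyperedge_slide k G e u v \<sigma> \<tau> .
  obtain \<sigma>' \<tau>' where "hyperedge_slide k G e v u \<sigma>' \<tau>'"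
    using ex_hyperedge_slide assms e by metis
  then interpret vu: hyperedge_slide k G e v u \<sigma>' \<tau>' .
  have near: "\<exists>r. nearest_vertex G e s r" if "s \<in> verts G" for s
    using ex_nearest_vertex[OF assms(2,4,6) _ that] assms(10) e by simp
  \<comment> \<open>A second edge has the same size k as \<open>e\<close>, so it cannot lie inside
    \<open>e\<close>; this yields a hanging vertex.\<close>
  obtain a where a: "a \<in> verts G - e"
  proof -
    have "edges G \<noteq> {e}" using assms(5) by auto
    then obtain f where f: "f \<in> edges G" "f \<noteq> e" using assms(6) by blast
    have "card f = k" using f assms(3) by (simp add: uniform_def)
    then have "\<not> f \<subseteq> e" using f(2) e assms(1) card_subset_eq[of e f]
      by (metis card.infinite not_numeral_le_zero)
    then show thesis using that f(1) assms(2) by (auto simp: hypergraph_def)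
  qed
  then obtain b where b: "nearest_vertex G e a b" using near by blast
  obtain x where x: "\<And>y. y \<in> verts ?H \<Longrightarrow> x y > 0"
    "\<And>y. y \<in> verts ?H \<Longrightarrow> (\<Sum>t\<in>verts ?H. real (hdist ?H y t) * x t) = ?l * x y"
    by (rule distance_Perron_vector[OF uv.paths.hypergraph_attach_two_paths
        uv.paths.hconnected_attach_two_paths]) (rule that)
  have swap: "bij_betw swap_paths (verts (attach_two_paths k G v u q' p')) (verts (attach_two_paths k G u v p' q'))"
    "\<And>y z. y \<in> verts (attach_two_paths k G v u q' p') \<Longrightarrow> z \<in> verts (attach_two_paths k G v u q' p') \<Longrightarrow>
      hdist (attach_two_paths k G u v p' q') (swap_paths y) (swap_paths z)
        = hdist (attach_two_paths k G v u q' p') y z" for p' q'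
  proof -
    show 1: "bij_betw swap_paths (verts (attach_two_paths k G v u q' p')) (verts (attach_two_paths k G u v p' q'))"
      by (rule bij_betw_swap_paths)
    show "hdist (attach_two_paths k G u v p' q') (swap_paths y) (swap_paths z)
        = hdist (attach_two_paths k G v u q' p') y z"
      if "y \<in> verts (attach_two_paths k G v u q' p')" "z \<in> verts (attach_two_paths k G v u q' p')" for y z
      using that bij_betwE[OF 1]
      by (simp add: uv.paths.hdist_attach_two_paths vu.paths.hdist_attach_two_paths two_paths_dist_swap_paths)
  qed
  define L where "L = left_weight k p u x"
  define R where "R = right_weight k q v x"
  have right: "?l < distance_spectral_radius (attach_two_paths k G u v (p - 1) (q + 1))"
    if "L \<le> R" "L < R \<or> b \<noteq> v"
    by (rule uv.slide_increases[OF assms(11) x near _ a b]) (use that in \<open>simp_all add: L_def R_def\<close>)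
  have left: "?l < distance_spectral_radius (attach_two_paths k G u v (p + 1) (q - 1))"
    if "R \<le> L" "R < L \<or> b \<noteq> u"
  proof -
    \<comment> \<open>\<open>x'\<close> is the same Perron vector read on the mirrored hypergraph,
      where left and right weights trade places.\<close>
    define x' where "x' y = x (swap_paths y)" for y
    have W: "left_weight k q v x' = R" "right_weight k p u x' = L"
      by (simp_all add: L_def R_def left_weight_def right_weight_def x'_def)
    have "?l < distance_spectral_radius (attach_two_paths k G v u (q - 1) (p + 1))"
    proof (rule vu.slide_increases[OF assms(12) _ _ near _ a b])
      show "x' y > 0" if "y \<in> verts ?K" for y
        using x(1) bij_betwE[OF swap(1)] that by (auto simp: x'_def)
      show "(\<Sum>t\<in>verts ?K. real (hdist ?K y t) * x' t) = ?l * x' y" if "y \<in> verts ?K" for y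
        unfolding x'_def by (rule eigenvector_isometry[OF swap x(2) that])
    qed (use that W in auto)
    also have "\<dots> = distance_spectral_radius (attach_two_paths k G u v (p + 1) (q - 1))"
      by (rule distance_spectral_radius_isometry[OF vu.paths.hypergraph_attach_two_paths
            uv.paths.hypergraph_attach_two_paths uv.paths.hconnected_attach_two_paths swap])
    finally show ?thesis .
  qed
  \<comment> \<open>In a tie \<open>b\<close> decides: it cannot equal both \<open>u\<close> and
    \<open>v\<close>, so \<open>a\<close> has a surplus in at least one direction.\<close>
  consider "L < R" | "R < L" | "L = R" "b \<noteq> v" | "L = R" "b = v" by linarith
  then show ?thesis
    using right left assms(9) by cases auto
qed

end
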